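(* Let $k\ge 2$. For every $\boldsymbol\alpha\in\Delta$, the $\boldsymbol\alpha$-infimax sequence satisfies $\mathcal{I}(\boldsymbol\alpha)=S(\Phi(\boldsymbol\alpha))$; that is, the infimum of $\mathcal{M}(\boldsymbol\alpha)$ in the lexicographic order on $\Sigma$ is $S(\Phi(\boldsymbol\alpha))$.
   Context: Fix an integer $k\ge 2$; $\mathbb{N}=\{0,1,2,\ldots\}$. Let $\mathcal{A}=\{1,\ldots,k\}$, and let $\Sigma=\mathcal{A}^{\mathbb{N}}$ be the space of sequences $w=(w_r)_{r\ge0}$, ordered lexicographically and with the product topology ($\mathcal{A}$ discrete). Let $\mathcal{A}^*$ be the set of non-empty finite words over $\mathcal{A}$; for $W\in\mathcal{A}^*$, $|W|$ is its length, $|W|_i$ the number of occurrences of the letter $i$ in $W$, $\overline{W}=WWW\cdots\in\Sigma$, and $W^n$ is the $n$-fold repetition of $W$ (the empty word if $n=0$). For $w\in\Sigma$, $w^{(r)}=w_0\ldots w_{r-1}$. The shift $\sigma:\Sigma\to\Sigma$ is $\sigma(w)_r=w_{r+1}$. A sequence $w\in\Sigma$ is maximal if $\sigma^r(w)\le w$ for all $r\ge0$; $\mathcal{M}\subset\Sigma$ is the set of maximal sequences. Let $\Delta=\{\boldsymbol\alpha\in\mathbb{R}_{\ge0}^k:\alpha_k>0,\ \sum_i\alpha_i=1\}$. For $W\in\mathcal{A}^*$, $\boldsymbol\rho(W)\in\mathbb{Q}^k$ has $i$th entry $|W|_i/|W|$. For $\boldsymbol\alpha\in\Delta$ let $\mathcal{R}(\boldsymbol\alpha)=\{w\in\Sigma:\boldsymbol\rho(w^{(r)})\to\boldsymbol\alpha\text{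 as }r\to\infty\}$, $\mathcal{M}(\boldsymbol\alpha)=\mathcal{M}\cap\mathcal{R}(\boldsymbol\alpha)$ (which is non-empty), and $\mathcal{I}(\boldsymbol\alpha)=\inf\mathcal{M}(\boldsymbol\alpha)$ (infimum in $\Sigma$; every non-empty subset of $\Sigma$ has an infimum). Let $J(\boldsymbol\alpha)=\lfloor\alpha_1/\alpha_k\rfloor$ and $\Delta_n=\{\boldsymbol\alpha\in\Delta:J(\boldsymbol\alpha)=n\}$ for $n\in\mathbb{N}$. Define $K_n:\Delta_n\to\Delta$ by $$K_n(\boldsymbol\alpha)=\frac{1}{1-\alpha_1}\bigl(\alpha_2,\alpha_3,\ldots,\alpha_{k-1},\ \alpha_1-n\alpha_k,\ (n+1)\alpha_k-\alpha_1\bigr),$$ $K:\Delta\to\Delta$ by $K(\boldsymbol\alpha)=K_{J(\boldsymbol\alpha)}(\boldsymbol\alpha)$, and the itinerary map $\Phi:\Delta\to\mathbb{N}^{\mathbb{N}}$ by $\Phi(\boldsymbol\alpha)_r=J(K^r(\boldsymbol\alpha))$. For $n\in\mathbb{N}$ the substitution $\Lambda_n:\mathcal{A}\to\mathcal{A}^*$ is: $\Lambda_n(i)=i+1$ (a single letter) for $1\le i\le k-2$, $\Lambda_n(k-1)=k\,1^{n+1}$, $\Lambda_n(k)=k\,1^n$; it is extended to $\mathcal{A}^*$ and $\Sigma$ by replacing each letter with its image. For $\mathbf{n}=(n_r)\in\mathbb{N}^{\mathbb{N}}$ set $\Lambda_{\mathbf{n},r}=\Lambda_{n_0}\circ\Lambda_{n_1}\circ\cdots\circ\Lambda_{n_r}$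 and $S(\mathbf{n})=\lim_{r\to\infty}\overline{\Lambda_{\mathbf{n},r}(k)}\in\Sigma$ (the limit exists since $\Lambda_{\mathbf{n},r}(k)$ is an initial subword of $\Lambda_{\mathbf{n},r+1}(k)$ for all $r$). *)

theory Defs
  imports "HOL-Analysis.Analysis" "HOL-Library.Fun_Lexorder"
begin

text \<open>
  The size \<open>k\<close> of the alphabet is an explicit parameter. Letters are the naturals
  \<open>1, \<dots>, k\<close>; finite words are lists of letters; sequences are functions on \<open>nat\<close>. Vectors
  in \<open>k\<close>-dimensional space are functions \<open>nat \<Rightarrow> real\<close> with coordinates indexed by \<open>{1..k}\<close>
  and the value 0 outside.
  The type \<open>nat \<Rightarrow> nat\<close> carries the product topology (of discrete spaces) as its class
  instance. Its class order is the pointwise one and is not used for sequences: those are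
  compared by \<open>lex_le\<close>.
\<close>

definition alphabet :: "nat \<Rightarrow> nat set" where
  "alphabet k = {1..k}"

definition seqs :: "nat \<Rightarrow> (nat \<Rightarrow> nat) set" where
  "seqs k = {w. \<forall>r. w r \<in> alphabet k}"

definition lex_le :: "(nat \<Rightarrow> nat) \<Rightarrow> (nat \<Rightarrow> nat) \<Rightarrow> bool" where
  "lex_le v w \<longleftrightarrow> less_fun v w \<or> v = w"

definition is_seq_inf :: "nat \<Rightarrow> (nat \<Rightarrow> nat) set \<Rightarrow> (nat \<Rightarrow> nat) \<Rightarrow> bool" where
  "is_seq_inf k X m \<longleftrightarrow>
     m \<in> seqs k \<and> (\<forall>w\<in>X. lex_le m w) \<and>
     (\<forall>l\<in>seqs k. (\<forall>w\<in>X. lex_le l w) \<longrightarrow> lex_le l m)"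

definition seq_inf :: "nat \<Rightarrow> (nat \<Rightarrow> nat) set \<Rightarrow> nat \<Rightarrow> nat" where
  "seq_inf k X = (THE m. is_seq_inf k X m)"

definition shift :: "(nat \<Rightarrow> nat) \<Rightarrow> nat \<Rightarrow> nat" where
  "shift w = (\<lambda>r. w (Suc r))"

definition initial_word :: "(nat \<Rightarrow> nat) \<Rightarrow> nat \<Rightarrow> nat list" where
  "initial_word w r = map w [0..<r]"

text \<open>Intended for non-empty words only.\<close>

definition periodic_seq :: "nat list \<Rightarrow> nat \<Rightarrow> nat" where
  "periodic_seq W = (\<lambda>r. W ! (r mod length W))"

definition maximal_seqs :: "nat \<Rightarrow> (nat \<Rightarrow> nat) set" where
  "maximal_seqs k = {w \<in> seqs k. \<forall>r. lex_le ((shift ^^ r) w) w}"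

definition Simplex :: "nat \<Rightarrow> (nat \<Rightarrow> real) set" where
  "Simplex k = {\<alpha>. (\<forall>i\<in>{1..k}. 0 \<le> \<alpha> i) \<and> (\<forall>i. i \<notin> {1..k} \<longrightarrow> \<alpha> i = 0) \<and>
                   0 < \<alpha> k \<and> (\<Sum>i\<in>{1..k}. \<alpha> i) = 1}"

definition freq :: "nat list \<Rightarrow> nat \<Rightarrow> real" where
  "freq W = (\<lambda>i. real (count_list W i) / real (length W))"

definition rate_seqs :: "nat \<Rightarrow> (nat \<Rightarrow> real) \<Rightarrow> (nat \<Rightarrow> nat) set" where
  "rate_seqs k \<alpha> =
     {w \<in> seqs k. \<forall>i\<in>{1..k}. (\<lambda>r. freq (initial_word w r) i) \<longlonglongrightarrow> \<alpha> i}"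

definition maximal_rate_seqs :: "nat \<Rightarrow> (nat \<Rightarrow> real) \<Rightarrow> (nat \<Rightarrow> nat) set" where
  "maximal_rate_seqs k \<alpha> = maximal_seqs k \<inter> rate_seqs k \<alpha>"

definition infimax :: "nat \<Rightarrow> (nat \<Rightarrow> real) \<Rightarrow> nat \<Rightarrow> nat" where
  "infimax k \<alpha> = seq_inf k (maximal_rate_seqs k \<alpha>)"

definition J :: "nat \<Rightarrow> (nat \<Rightarrow> real) \<Rightarrow> nat" where
  "J k \<alpha> = nat \<lfloor>\<alpha> 1 / \<alpha> k\<rfloor>"

definition K_branch :: "nat \<Rightarrow> nat \<Rightarrow> (nat \<Rightarrow> real) \<Rightarrow> nat \<Rightarrow> real" where
  "K_branch k n \<alpha> = (\<lambda>i.
     if i = k then (real (n + 1) * \<alpha> k - \<alpha> 1) / (1 - \<alpha> 1)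
     else if i = k - 1 then (\<alpha> 1 - real n * \<alpha> k) / (1 - \<alpha> 1)
     else if 1 \<le> i \<and> i < k - 1 then \<alpha> (i + 1) / (1 - \<alpha> 1)
     else 0)"

definition K_map :: "nat \<Rightarrow> (nat \<Rightarrow> real) \<Rightarrow> nat \<Rightarrow> real" where
  "K_map k \<alpha> = K_branch k (J k \<alpha>) \<alpha>"

definition itinerary :: "nat \<Rightarrow> (nat \<Rightarrow> real) \<Rightarrow> nat \<Rightarrow> nat" where
  "itinerary k \<alpha> = (\<lambda>r. J k ((K_map k ^^ r) \<alpha>))"

definition subst_letter :: "nat \<Rightarrow> nat \<Rightarrow> nat \<Rightarrow> nat list" where
  "subst_letter k n i =
     (if i = k then k # replicate n 1
      else if i = k - 1 then k # replicate (n + 1) 1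
      else [i + 1])"

definition subst_word :: "nat \<Rightarrow> nat \<Rightarrow> nat list \<Rightarrow> nat list" where
  "subst_word k n W = concat (map (subst_letter k n) W)"

primrec subst_comp :: "nat \<Rightarrow> (nat \<Rightarrow> nat) \<Rightarrow> nat \<Rightarrow> nat list \<Rightarrow> nat list" where
  "subst_comp k ns 0 = subst_word k (ns 0)"
| "subst_comp k ns (Suc r) = subst_comp k ns r \<circ> subst_word k (ns (Suc r))"

definition S_seq :: "nat \<Rightarrow> (nat \<Rightarrow> nat) \<Rightarrow> nat \<Rightarrow> nat" where
  "S_seq k ns = (THE s. (\<lambda>r. periodic_seq (subst_comp k ns r [k])) \<longlonglongrightarrow> s)"


text \<open>Well-definedness of \<open>S_seq\<close>, \<open>seq_inf\<close> and the iterates of \<open>K_map\<close>.\<close>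

lemma subst_comp_append:
  "subst_comp k ns r (U @ V) = subst_comp k ns r U @ subst_comp k ns r V"
  by (induction r arbitrary: U V) (simp_all add: subst_word_def)

lemma subst_comp_prefix:
  "\<exists>V. subst_comp k ns (Suc r) [k] = subst_comp k ns r [k] @ V"
  using subst_comp_append[of k ns r "[k]" "replicate (ns (Suc r)) 1"]
  by (simp add: subst_word_def subst_letter_def)

lemma subst_comp_prefix_le:
  assumes "r \<le> s"
  shows "\<exists>V. subst_comp k ns s [k] = subst_comp k ns r [k] @ V"
  using assms
proof (induction s rule: dec_induct)
  case (step s)
  then show ?case using subst_comp_prefix[of k ns s] by (metis append.assoc)
qed simp

lemma subst_comp_nonempty: "subst_comp k ns r [k] \<noteq> []"
proof -
  have "subst_comp k ns 0 [k] \<noteq> []"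
    by (simp add: subst_word_def subst_letter_def)
  then show ?thesis using subst_comp_prefix_le[of 0 r k ns] by auto
qed

lemma seq_tendsto_iff:
  fixes f :: "nat \<Rightarrow> nat \<Rightarrow> nat"
  shows "f \<longlonglongrightarrow> l \<longleftrightarrow> (\<forall>j. (\<lambda>r. f r j) \<longlonglongrightarrow> l j)"
  using limitin_componentwise[of "\<lambda>_. euclidean" UNIV f l sequentially]
  by (simp add: euclidean_product_topology)

lemma seq_limit_unique:
  fixes f :: "nat \<Rightarrow> nat \<Rightarrow> nat"
  assumes "f \<longlonglongrightarrow> a" and "f \<longlonglongrightarrow> b"
  shows "a = b"
  using assms unfolding seq_tendsto_iff by (intro ext) (blast intro: LIMSEQ_unique)

lemma periodic_seq_subst_comp_tendsto:
  "(\<lambda>r. periodic_seq (subst_comp k ns r [k])) \<longlonglongrightarrow> S_seq k ns"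
proof -
  let ?W = "\<lambda>r. subst_comp k ns r [k]"
  have ev: "\<exists>c. \<forall>\<^sub>F r in sequentially. periodic_seq (?W r) j = c" for j
  proof (cases "\<exists>r. j < length (?W r)")
    case True
    then obtain r where r: "j < length (?W r)" by blast
    have "periodic_seq (?W s) j = ?W r ! j" if sr: "s \<ge> r" for s
    proof -
      obtain V where "?W s = ?W r @ V" using subst_comp_prefix_le[OF sr] by blast
      with r show ?thesis by (simp add: periodic_seq_def nth_append)
    qed
    then show ?thesis unfolding eventually_sequentially by blast
  next
    case False
    define N where "N = Max (range (\<lambda>r. length (?W r)))"
    have "range (\<lambda>r. length (?W r)) \<subseteq> {..j}" using False by (auto simp: not_less)
    then have fin: "finite (range (\<lambda>r. length (?W r)))" by (rule finite_subset) simp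
    then have "N \<in> range (\<lambda>r. length (?W r))" unfolding N_def by (intro Max_in) auto
    then obtain r where r: "length (?W r) = N" by auto
    have "?W s = ?W r" if sr: "s \<ge> r" for s
    proof -
      obtain V where V: "?W s = ?W r @ V" using subst_comp_prefix_le[OF sr] by blast
      moreover have "length (?W s) \<le> N" unfolding N_def using fin by (intro Max_ge) auto
      ultimately show ?thesis using r by simp
    qed
    then have "\<forall>s\<ge>r. periodic_seq (?W s) j = periodic_seq (?W r) j" by metis
    then show ?thesis unfolding eventually_sequentially by blast
  qed
  then have "\<forall>j. \<exists>c. \<forall>\<^sub>F r in sequentially. periodic_seq (?W r) j = c" by blast
  from choice[OF this] obtain c
    where c: "\<And>j. \<forall>\<^sub>F r in sequentially. periodic_seq (?W r) j = c j" by blast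
  have lim: "(\<lambda>r. periodic_seq (?W r)) \<longlonglongrightarrow> c"
    unfolding seq_tendsto_iff
  proof
    fix j show "(\<lambda>r. periodic_seq (?W r) j) \<longlonglongrightarrow> c j"
      using c[of j] by (rule tendsto_eventually)
  qed
  show ?thesis unfolding S_seq_def
    by (rule theI[where P = "\<lambda>s. (\<lambda>r. periodic_seq (?W r)) \<longlonglongrightarrow> s",
          OF lim seq_limit_unique[OF _ lim]])
qed

lemma lex_le_antisym: "lex_le v w \<Longrightarrow> lex_le w v \<Longrightarrow> v = w"
  unfolding lex_le_def using less_fun_asym by blast

lemma seq_inf_eqI: "is_seq_inf k X m \<Longrightarrow> seq_inf k X = m"
  unfolding seq_inf_def
proof (rule the_equality)
  fix m' assume "is_seq_inf k X m" "is_seq_inf k X m'"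
  then show "m' = m" unfolding is_seq_inf_def by (blast intro: lex_le_antisym)
qed

lemma K_map_in_Simplex:
  assumes k: "k \<ge> 2" and a: "\<alpha> \<in> Simplex k"
  shows "K_map k \<alpha> \<in> Simplex k"
proof -
  define n where "n = J k \<alpha>"
  have ak: "\<alpha> k > 0" and nn: "\<And>i. i \<in> {1..k} \<Longrightarrow> 0 \<le> \<alpha> i" and s1: "(\<Sum>i\<in>{1..k}. \<alpha> i) = 1"
    using a by (auto simp: Simplex_def)
  have a1: "\<alpha> 1 \<ge> 0" using nn k by simp
  have "\<alpha> 1 / \<alpha> k \<ge> 0" using a1 ak by simp
  then have "real n = of_int \<lfloor>\<alpha> 1 / \<alpha> k\<rfloor>" by (simp add: n_def J_def)
  then have "real n \<le> \<alpha> 1 / \<alpha> k" "\<alpha> 1 / \<alpha> k < real n + 1" by linarith+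
  then have lo: "real n * \<alpha> k \<le> \<alpha> 1" and hi: "\<alpha> 1 < (real n + 1) * \<alpha> k"
    using ak by (simp_all add: field_simps)
  have split: "{1..k} = insert k (insert (k - 1) {1..<k - 1})" using k by auto
  have split': "{1..k} = insert 1 (insert k {2..<k})" using k by auto
  have sa: "\<alpha> 1 + \<alpha> k + (\<Sum>i\<in>{2..<k}. \<alpha> i) = 1"
    using s1 k unfolding split' by simp
  have "(\<Sum>i\<in>{2..<k}. \<alpha> i) \<ge> 0" by (rule sum_nonneg) (use nn in auto)
  then have pos: "1 - \<alpha> 1 > 0" using sa ak by linarith
  have tail: "(\<Sum>i\<in>{1..<k - 1}. \<alpha> (i + 1)) = (\<Sum>i\<in>{2..<k}. \<alpha> i)"
    using sum.shift_bounds_nat_ivl[of \<alpha> 1 1 "k - 1"] k by (simp add: numeral_2_eq_2)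
  have mid: "(\<Sum>i\<in>{1..<k - 1}. K_branch k n \<alpha> i) = (\<Sum>i\<in>{2..<k}. \<alpha> i) / (1 - \<alpha> 1)"
    unfolding tail[symmetric] sum_divide_distrib
    by (rule sum.cong) (auto simp: K_branch_def)
  have fresh: "k \<notin> insert (k - 1) {1..<k - 1}" "k - 1 \<notin> {1..<k - 1}" using k by auto
  have "(\<Sum>i\<in>{1..k}. K_branch k n \<alpha> i) =
    K_branch k n \<alpha> k + (K_branch k n \<alpha> (k - 1) + (\<Sum>i\<in>{1..<k - 1}. K_branch k n \<alpha> i))"
    using fresh unfolding split by (simp only: sum.insert finite_insert finite_atLeastLessThan
        not_False_eq_True)
  also have "\<dots> = 1"
  proof -
    have "K_branch k n \<alpha> k = (real (n + 1) * \<alpha> k - \<alpha> 1) / (1 - \<alpha> 1)"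
      "K_branch k n \<alpha> (k - 1) = (\<alpha> 1 - real n * \<alpha> k) / (1 - \<alpha> 1)"
      using k by (auto simp: K_branch_def)
    moreover have "(real (n + 1) * \<alpha> k - \<alpha> 1) + ((\<alpha> 1 - real n * \<alpha> k) + (\<Sum>i\<in>{2..<k}. \<alpha> i)) = 1 - \<alpha> 1"
      using sa by (simp add: distrib_right)
    ultimately show ?thesis
      unfolding mid using pos by (simp only: add_divide_distrib[symmetric]) simp
  qed
  finally have "(\<Sum>i\<in>{1..k}. K_branch k n \<alpha> i) = 1" .
  moreover have "0 \<le> K_branch k n \<alpha> i" if "i \<in> {1..k}" for i
    using that lo hi pos nn[of "i + 1"] by (auto simp: K_branch_def add.commute)
  moreover have "K_branch k n \<alpha> i = 0" if "i \<notin> {1..k}" for i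
    using that k by (auto simp: K_branch_def)
  moreover have "0 < K_branch k n \<alpha> k" using hi pos by (simp add: K_branch_def add.commute)
  ultimately show ?thesis by (simp add: Simplex_def K_map_def n_def)
qed

end

theory Submission
  imports Defs
begin

text \<open>
  Lower bound. Suppose all suffixes of a finite word \<open>W\<close> are below \<open>\<Lambda>\<^sub>n(T)\<close>, where \<open>n = J(\<alpha>)\<close> and \<open>T\<close>
  begins with \<open>k\<close>. Cut \<open>W\<close> into \<open>\<Lambda>\<^sub>n\<close>-images of letters and some surplus letters 1, and cancel each
  surplus 1 against an earlier \<open>k\<close>, which becomes \<open>k - 1\<close>. All suffixes of the resulting word are below
  \<open>T\<close>, and its vector of letter counts is, up to a bounded error, the image of that of \<open>W\<close> under the
  linear map underlying \<open>K\<^sub>n\<close>. If a maximal \<open>w\<close> of rate \<open>\<alpha>\<close> were smaller than \<open>S(\<Phi>(\<alpha>))\<close>, then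
  iterating this on its prefixes would yield words in which the letter \<open>k\<close> has frequency
  \<open>(K\<^sup>r(\<alpha>))\<^sub>k > 0\<close> but occurs at most once.

  Approximation. The substitutions \<open>\<Lambda>\<^sub>n\<close> preserve the lexicographic order and hence maximality, so they
  carry maximal sequences of rate \<open>K\<^sup>r\<^sup>+\<^sup>1(\<alpha>)\<close> with a long initial run of \<open>k\<close> to maximal sequences of rate
  \<open>\<alpha>\<close> sharing a long prefix with \<open>S(\<Phi>(\<alpha>))\<close>.
\<close>

subsection \<open>Desubstitution of finite words\<close>

text \<open>A word that ends before it differs from the bound counts as below it; a proper extension of the
  bound does not.\<close>

fun below :: "nat list \<Rightarrow> nat list \<Rightarrow> bool" where
  "below [] T = True"
| "below (x # xs) [] = False"
| "below (x # xs) (y # ys) = (x < y \<or> x = y \<and> below xs ys)"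

fun all_below :: "nat list \<Rightarrow> nat list \<Rightarrow> bool" where
  "all_below T [] = True"
| "all_below T (x # xs) = (below (x # xs) T \<and> all_below T xs)"

text \<open>Surplus letters 1 become the extra letter 0. A final block \<open>k 1 \<dots> 1\<close> that may be cut off is dropped,
  since its continuation decides between \<open>k - 1\<close> and \<open>k\<close>.\<close>

fun desub :: "nat \<Rightarrow> nat \<Rightarrow> nat list \<Rightarrow> nat list" where
  "desub k n [] = []"
| "desub k n (x # xs) =
    (if x \<noteq> k then (x - 1) # desub k n xs
     else if take (n + 1) xs = replicate (n + 1) 1 then (k - 1) # desub k n (drop (n + 1) xs)
     else if take n xs = replicate n 1 \<and> n < length xs then k # desub k n (drop n xs)
     else [])"

text \<open>Reads the word from the right and matches zeros with preceding letters \<open>k\<close>, like brackets; the first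
  component counts the unmatched zeros.\<close>

fun cancel :: "nat \<Rightarrow> nat list \<Rightarrow> nat \<times> nat list" where
  "cancel k [] = (0, [])"
| "cancel k (x # xs) =
    (let (c, ys) = cancel k xs in
     if x = 0 then (Suc c, ys)
     else if x = k \<and> 0 < c then (c - 1, (k - 1) # ys)
     else (c, x # ys))"

text \<open>Disposes of the zeros that \<open>cancel\<close> leaves unmatched: no free
  \<open>k\<close> precedes them, so the first \<open>c\<close> letters \<open>k\<close> are lowered
  instead. Lowering letters keeps a word below its bound.\<close>

fun demote :: "nat \<Rightarrow> nat \<Rightarrow> nat list \<Rightarrow> nat list" where
  "demote k c [] = []"
| "demote k c (x # xs) =
    (if x = k \<and> 0 < c then (k - 1) # demote k (c - 1) xs else x # demote k c xs)"

lemma subst_word_simps [simp]: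
  "subst_word k n [] = []"
  "subst_word k n (x # xs) = subst_letter k n x @ subst_word k n xs"
  "subst_word k n (xs @ ys) = subst_word k n xs @ subst_word k n ys"
  by (simp_all add: subst_word_def)

lemma set_subst_word:
  assumes "k \<ge> 2" "set W \<subseteq> {1..k}"
  shows "set (subst_word k n W) \<subseteq> {1..k}"
  using assms by (induction W) (auto simp: subst_letter_def set_replicate_conv_if split: if_splits)

lemma below_append: "below xs ys \<Longrightarrow> below xs (ys @ zs)"
  by (induction xs ys rule: below.induct) auto

lemma all_below_append: "all_below T W \<Longrightarrow> all_below (T @ zs) W"
  by (induction T W rule: all_below.induct) (auto intro: below_append simp del: below.simps)

lemma all_below_drop: "all_below T W \<Longrightarrow> all_below T (drop m W)"
  by (induction W arbitrary: m) (auto simp: drop_Cons split: nat.splits simp del: below.simps)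

lemma below_append_same: "below (xs @ ys) (xs @ zs) = below ys zs"
  by (induction xs) auto

text \<open>No letter is smaller than 1, so within the run of ones the word can only follow it or
  end.\<close>

lemma below_replicate:
  assumes "below xs (replicate n 1 @ R)" "set xs \<subseteq> {1..}"
  shows "take n xs = replicate n 1 \<or> length xs \<le> n \<and> xs = replicate (length xs) 1"
  using assms
proof (induction n arbitrary: xs)
  case (Suc n)
  show ?case
  proof (cases xs)
    case (Cons x ys)
    with Suc.prems have "x = 1" "below ys (replicate n 1 @ R)" "set ys \<subseteq> {1..}" by auto
    with Suc.IH[of ys] Cons show ?thesis by auto
  qed simp
qed simp

text \<open>\<open>\<Lambda>\<^sub>n\<close> reflects the order image by image. A letter less than
  \<open>k\<close> lies below every image starting with \<open>k\<close>; a block \<open>k\<close>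
  with n + 1 ones can only face \<open>k - 1\<close> or the larger \<open>k\<close>; a block with
  exactly n ones cannot face \<open>k - 1\<close>, whose image goes on with a further 1.\<close>

lemma below_desub:
  assumes "k \<ge> 2" "set W \<subseteq> {1..k}" "set T \<subseteq> {1..k}" "below W (subst_word k n T)"
  shows "below (desub k n W) T"
  using assms(2-4)
proof (induction k n W arbitrary: T rule: desub.induct)
  case (2 k n x xs)
  show ?case
  proof (cases T)
    case Nil
    with 2 show ?thesis by simp
  next
    case (Cons y T')
    have xk: "1 \<le> x" "x \<le> k" "set xs \<subseteq> {1..k}" and y: "1 \<le> y" "y \<le> k" "set T' \<subseteq> {1..k}"
      using 2 Cons by auto
    have b: "below (x # xs) (subst_letter k n y @ subst_word k n T')"
      using 2 Cons by simp
    show ?thesis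
    proof (cases "x = k")
      case False
      with b xk y "2.IH"(1)[OF False xk(3) y(3)] Cons show ?thesis
        by (cases "y = k \<or> y = k - 1") (auto simp: subst_letter_def split: if_splits)
    next
      case xk': True
      show ?thesis
      proof (cases "take (n + 1) xs = replicate (n + 1) 1")
        case True
        then have xs: "xs = replicate (n + 1) 1 @ drop (n + 1) xs"
          using append_take_drop_id[of "n + 1" xs] by (simp only: True)
        have s: "set (drop (n + 1) xs) \<subseteq> {1..k}" by (rule order_trans[OF set_drop_subset xk(3)])
        consider "y = k" | "y = k - 1" "y \<noteq> k" | "y < k - 1" using y by linarith
        then show ?thesis
        proof cases
          case 2
          have "below xs (replicate (n + 1) 1 @ subst_word k n T')"
            using b xk' 2 y by (simp add: subst_letter_def)
          then have "below (replicate (n + 1) 1 @ drop (n + 1) xs) (replicate (n + 1) 1 @ subst_word k n T')"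
            by (subst (asm) xs)
          then have "below (drop (n + 1) xs) (subst_word k n T')"
            by (simp only: below_append_same)
          with "2.IH"(2)[OF _ True s y(3)] xk' 2 Cons True show ?thesis by simp
        qed (use b xk' y Cons True in \<open>auto simp: subst_letter_def split: if_splits\<close>)
      next
        case nf: False
        show ?thesis
        proof (cases "take n xs = replicate n 1 \<and> n < length xs")
          case True
          then have xs: "xs = replicate n 1 @ drop n xs"
            using append_take_drop_id[of n xs] by (simp only: True)
          have s: "set (drop n xs) \<subseteq> {1..k}" by (rule order_trans[OF set_drop_subset xk(3)])
          consider "y = k" | "y = k - 1" "y \<noteq> k" | "y < k - 1" using y by linarith
          then show ?thesis
          proof cases
            case 1
            have "below xs (replicate n 1 @ subst_word k n T')"
              using b xk' 1 y by (simp add: subst_letter_def)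
            then have "below (replicate n 1 @ drop n xs) (replicate n 1 @ subst_word k n T')"
              by (subst (asm) xs)
            then have "below (drop n xs) (subst_word k n T')"
              by (simp only: below_append_same)
            with "2.IH"(3)[OF _ nf True s y(3)] xk' 1 Cons nf True show ?thesis by simp
          next
            case 2
            have "below xs (replicate n 1 @ 1 # subst_word k n T')"
              using b xk' 2 y by (simp add: subst_letter_def replicate_app_Cons_same)
            then have "below (replicate n 1 @ drop n xs) (replicate n 1 @ 1 # subst_word k n T')"
              by (subst (asm) xs)
            then have "below (drop n xs) (1 # subst_word k n T')"
              by (simp only: below_append_same)
            \<comment> \<open>\<open>n < length xs\<close> supplies a letter after the n ones. Being
              bounded by 1 it equals 1, so the block would have been read as
              \<open>k - 1\<close>.\<close>
            moreover obtain z zs where z: "drop n xs = z # zs" using True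
              by (cases "drop n xs") auto
            moreover have "1 \<le> z" using s z by simp
            ultimately have "z = 1" by auto
            then have "take (n + 1) xs = replicate (n + 1) 1"
              by (subst xs) (simp add: z replicate_append_same)
            with nf show ?thesis by simp
          next
            case 3
            with b xk' y Cons show ?thesis by (auto simp: subst_letter_def split: if_splits)
          qed
        qed (use xk' nf in auto)
      qed
    qed
  qed
qed simp

text \<open>Every suffix of \<open>desub k n W\<close> is \<open>desub\<close> of the suffix of
  \<open>W\<close> that starts at the corresponding block.\<close>

lemma all_below_desub:
  assumes "k \<ge> 2" "set W \<subseteq> {1..k}" "set T \<subseteq> {1..k}" "all_below (subst_word k n T) W"
  shows "all_below T (desub k n W)"
  using assms
proof (induction k n W rule: desub.induct)
  case (2 k n x xs)
  have b: "below (desub k n (x # xs)) T"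
    using 2 by (intro below_desub) (auto simp del: below.simps)
  have d: "set (drop m xs) \<subseteq> {1..k}" "all_below (subst_word k n T) (drop m xs)" for m
    using "2.prems" order_trans[OF set_drop_subset[of m xs]]
    by (simp_all add: all_below_drop del: below.simps)
  consider "x \<noteq> k" | "x = k" "take (n + 1) xs = replicate (n + 1) 1"
    | "x = k" "take (n + 1) xs \<noteq> replicate (n + 1) 1" "take n xs = replicate n 1 \<and> n < length xs"
    | "x = k" "take (n + 1) xs \<noteq> replicate (n + 1) 1" "\<not> (take n xs = replicate n 1 \<and> n < length xs)"
    by blast
  then show ?case
  proof cases
    case 1
    with "2.IH"(1)[OF 1 "2.prems"(1) _ "2.prems"(3)] d[of 0] b show ?thesis by (simp del: below.simps)
  next
    case c: 2
    with "2.IH"(2)[OF _ c(2) "2.prems"(1) d(1) "2.prems"(3) d(2)] b show ?thesis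
      by (simp del: below.simps take_Suc_Cons replicate.simps)
  next
    case 3
    with "2.IH"(3)[OF _ 3(2,3) "2.prems"(1) d(1) "2.prems"(3) d(2)] b show ?thesis
      by (simp del: below.simps take_Suc_Cons replicate.simps)
  next
    case 4
    then show ?thesis by (auto simp del: take_Suc_Cons replicate.simps)
  qed
qed simp

lemma set_desub: "set W \<subseteq> {1..k} \<Longrightarrow> set (desub k n W) \<subseteq> {0..k}"
proof (induction k n W rule: desub.induct)
  case (2 k n x xs)
  have d: "set (drop m xs) \<subseteq> {1..k}" for m
    using "2.prems" order_trans[OF set_drop_subset[of m xs]] by simp
  have x: "x - 1 \<in> {0..k}" using "2.prems" by auto
  consider "x \<noteq> k" | "x = k" "take (n + 1) xs = replicate (n + 1) 1"
    | "x = k" "take (n + 1) xs \<noteq> replicate (n + 1) 1" "take n xs = replicate n 1 \<and> n < length xs"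
    | "x = k" "take (n + 1) xs \<noteq> replicate (n + 1) 1" "\<not> (take n xs = replicate n 1 \<and> n < length xs)"
    by blast
  then show ?case
  proof cases
    case 1
    with "2.IH"(1)[OF 1] d[of 0] x show ?thesis by simp
  next
    case c: 2
    with "2.IH"(2)[OF _ c(2) d] show ?thesis by (simp del: take_Suc_Cons replicate.simps)
  next
    case 3
    with "2.IH"(3)[OF _ 3(2,3) d] show ?thesis by (simp del: take_Suc_Cons replicate.simps)
  next
    case 4
    then show ?thesis by (auto simp del: take_Suc_Cons replicate.simps)
  qed
qed simp

section \<open>Cancellation of the letters 0 and letter counts\<close>

lemma count_list_replicate [simp]: "count_list (replicate n x) y = (if x = y then n else 0)"
  by (induction n) auto

lemma count_list_le_length: "count_list xs x \<le> length xs"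
  by (induction xs) auto

text \<open>Without unmatched zeros, every removed 0 comes after the \<open>k\<close> that it
  lowers, so the first change turns a \<open>k\<close> into \<open>k - 1\<close>. If the comparison
  is still open there, \<open>T\<close> has the letter \<open>k\<close>, and the new word drops
  strictly below it.\<close>

lemma below_cancel:
  assumes "fst (cancel k u) = 0" "below u T" "set T \<subseteq> {1..k}" "k > 0"
  shows "below (snd (cancel k u)) T"
  using assms(1-3)
proof (induction u arbitrary: T)
  case (Cons x xs)
  then show ?case using \<open>k > 0\<close>
    by (cases T) (auto simp: Let_def case_prod_unfold split: if_splits)
qed simp

text \<open>A suffix of the result that starts with \<open>k\<close> comes from a suffix of
  \<open>u\<close> without unmatched zeros, where \<open>below_cancel\<close> applies. All other
  suffixes start with a letter less than \<open>k\<close>.\<close>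

lemma all_below_cancel:
  assumes "all_below (k # T) u" "set u \<subseteq> {0..k}" "set T \<subseteq> {1..k}" "k > 0"
  shows "all_below (k # T) (snd (cancel k u))"
  using assms(1,2)
proof (induction u)
  case (Cons x xs)
  show ?case
    using Cons below_cancel[of k "x # xs" "k # T"] assms(3,4)
    by (auto simp: Let_def case_prod_unfold split: if_splits)
qed simp

lemma set_cancel:
  "k \<ge> 2 \<Longrightarrow> set u \<subseteq> {0..k} \<Longrightarrow> set (snd (cancel k u)) \<subseteq> {1..k}"
  by (induction u) (auto simp: Let_def case_prod_unfold split: if_splits)

lemma count_cancel:
  fixes u :: "nat list"
  assumes "k \<ge> 2"
  defines "v \<equiv> snd (cancel k u)" and "c \<equiv> fst (cancel k u)"
  shows "1 \<le> i \<Longrightarrow> i < k - 1 \<Longrightarrow> count_list v i = count_list u i"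
    and "count_list v (k - 1) + c = count_list u (k - 1) + count_list u 0"
    and "count_list v k + count_list u 0 = count_list u k + c"
  unfolding v_def c_def using \<open>k \<ge> 2\<close>
  by (induction u) (auto simp: Let_def case_prod_unfold)

lemma below_demote: "below u T \<Longrightarrow> below (demote k c u) T"
  by (induction u T arbitrary: c rule: below.induct) auto

lemma all_below_demote: "all_below T u \<Longrightarrow> all_below T (demote k c u)"
proof (induction u arbitrary: c)
  case (Cons x xs)
  then show ?case using below_demote[of "x # xs" T k c]
    by (auto simp del: below.simps split: if_splits)
qed simp

lemma set_demote: "k \<ge> 2 \<Longrightarrow> set u \<subseteq> {1..k} \<Longrightarrow> set (demote k c u) \<subseteq> {1..k}"
  by (induction u arbitrary: c) auto

lemma count_demote:
  assumes "k \<ge> 2" "c \<le> count_list u k"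
  shows "i < k - 1 \<Longrightarrow> count_list (demote k c u) i = count_list u i"
    and "count_list (demote k c u) (k - 1) = count_list u (k - 1) + c"
    and "count_list (demote k c u) k + c = count_list u k"
proof -
  have z: "demote k 0 v = v" for v by (induction v) auto
  have n: "k - 1 \<noteq> k" using assms by simp
  show "i < k - 1 \<Longrightarrow> count_list (demote k c u) i = count_list u i"
    by (induction u arbitrary: c) auto
  show "count_list (demote k c u) (k - 1) = count_list u (k - 1) + c"
    using assms(2)
  proof (induction u arbitrary: c)
    case (Cons x xs)
    then show ?case using n by (cases c) (auto simp: z)
  qed simp
  show "count_list (demote k c u) k + c = count_list u k"
    using assms(2)
  proof (induction u arbitrary: c)
    case (Cons x xs)
    then show ?case using n Cons.IH[of c] Cons.IH[of "c - 1"] by (cases c) (auto simp: z)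
  qed simp
qed

text \<open>The losses n and 1 come from a single dropped block: the bound forbids \<open>k\<close>
  followed by fewer than n ones and then a larger letter, so \<open>desub\<close> stops early only
  at a final block, with one \<open>k\<close> and at most n ones.\<close>

lemma count_desub:
  assumes "k \<ge> 2" "set W \<subseteq> {1..k}" "all_below (k # replicate n 1 @ R) W"
  defines "u \<equiv> desub k n W"
  defines "a \<equiv> count_list u 0 + (n + 1) * count_list u (k - 1) + n * count_list u k"
  shows "(\<forall>i. 1 \<le> i \<longrightarrow> i < k - 1 \<longrightarrow> count_list u i = count_list W (i + 1)) \<and>
    a \<le> count_list W 1 \<and> count_list W 1 \<le> a + n \<and>
    count_list u (k - 1) + count_list u k \<le> count_list W k \<and>
    count_list W k \<le> count_list u (k - 1) + count_list u k + 1"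
  unfolding a_def u_def using assms(1-3)
proof (induction k n W rule: desub.induct)
  case (2 k n x xs)
  have d: "set (drop m xs) \<subseteq> {1..k}" "all_below (k # replicate n 1 @ R) (drop m xs)" for m
    using "2.prems" order_trans[OF set_drop_subset[of m xs]]
    by (simp_all add: all_below_drop del: below.simps)
  have x: "1 \<le> x" "x \<le> k" using "2.prems" by auto
  have k: "k \<ge> 2" "k - 1 \<noteq> k" "1 \<noteq> k" "0 \<noteq> k" "k - 1 \<noteq> 0" using "2.prems" by auto
  have cnt: "count_list xs i = count_list (take m xs) i + count_list (drop m xs) i" for m i
    by (metis append_take_drop_id count_list_append)
  consider "x \<noteq> k" | "x = k" "take (n + 1) xs = replicate (n + 1) 1"
    | "x = k" "take (n + 1) xs \<noteq> replicate (n + 1) 1" "take n xs = replicate n 1 \<and> n < length xs"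
    | "x = k" "take (n + 1) xs \<noteq> replicate (n + 1) 1"
        "\<not> (take n xs = replicate n 1 \<and> n < length xs)" by blast
  then show ?case
  proof cases
    case 1
    have e: "desub k n (x # xs) = (x - 1) # desub k n xs" using 1 by simp
    have "x - 1 = i \<longleftrightarrow> x = i + 1" for i using x by auto
    moreover have "x - 1 \<noteq> k - 1" "x - 1 \<noteq> k" using 1 x by auto
    ultimately show ?thesis
      using "2.IH"(1)[OF 1 k(1) d[of 0, unfolded drop_0]] 1 x(1) unfolding e by auto
  next
    case c: 2
    have e: "desub k n (x # xs) = (k - 1) # desub k n (drop (n + 1) xs)"
      unfolding desub.simps using c by (simp only: if_True if_False simp_thms)
    have "count_list xs i = (if i = 1 then n + 1 else 0) + count_list (drop (n + 1) xs) i" for i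
      by (subst cnt[of i "n + 1"], subst c(2)) (simp del: replicate.simps)
    then show ?thesis
      using "2.IH"(2)[OF _ c(2) k(1) d] c(1) k unfolding e by simp
  next
    case 3
    have e: "desub k n (x # xs) = k # desub k n (drop n xs)"
      unfolding desub.simps using 3 by (simp only: if_True if_False simp_thms)
    have "count_list xs i = (if i = 1 then n else 0) + count_list (drop n xs) i" for i
      by (subst cnt[of i n], subst 3(3)[THEN conjunct1]) simp
    then show ?thesis
      using "2.IH"(3)[OF _ 3(2,3) k(1) d] 3(1) k unfolding e by simp
  next
    case 4
    have e: "desub k n (x # xs) = []"
      unfolding desub.simps using 4 by (simp only: if_True if_False simp_thms)
    have "below xs (replicate n 1 @ R)" "set xs \<subseteq> {1..}"
      using "2.prems" 4(1) by auto
    from below_replicate[OF this] 4(3) have l: "length xs \<le> n" and r: "xs = replicate (length xs) 1"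
      by auto
    have "count_list xs i = (if i = 1 then length xs else 0)" for i
      by (subst r) simp
    with 4(1) l k show ?thesis unfolding e by simp
  qed
qed simp

text \<open>One step of the linear map underlying \<open>K\<^sub>n\<close>, on letter counts. The
  premise of the implication ensures that enough letters \<open>k\<close> are available for the
  unmatched zeros; for \<open>n = J k \<alpha>\<close> it follows in the limit from
  \<open>\<alpha> 1 < (n + 1) * \<alpha> k\<close>.\<close>

lemma desub_step:
  assumes k: "k \<ge> 2" and W: "set W \<subseteq> {1..k}" and T: "set T \<subseteq> {1..k}"
    and ab: "all_below (subst_word k n (k # T)) W"
  shows "\<exists>v. set v \<subseteq> {1..k} \<and> all_below (k # T) v \<and>
    (real (n + 1) \<le> real (n + 1) * real (count_list W k) - real (count_list W 1) \<longrightarrow>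
      (\<forall>i. 1 \<le> i \<longrightarrow> i < k - 1 \<longrightarrow> count_list v i = count_list W (i + 1)) \<and>
      \<bar>real (count_list v (k - 1)) - (real (count_list W 1) - real n * real (count_list W k))\<bar>
        \<le> real (n + 1) \<and>
      \<bar>real (count_list v k) - (real (n + 1) * real (count_list W k) - real (count_list W 1))\<bar>
        \<le> real (n + 1))"
proof -
  define u where "u = desub k n W"
  define c where "c = fst (cancel k u)"
  define w where "w = snd (cancel k u)"
  define v where "v = demote k c w"
  have ab': "all_below (k # replicate n 1 @ subst_word k n T) W"
    using ab by (simp add: subst_letter_def)
  note cd = count_desub[OF k W ab', folded u_def]
  have u: "set u \<subseteq> {0..k}" "all_below (k # T) u"
    unfolding u_def using set_desub all_below_desub[OF k W _ ab] W T k by auto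
  have w: "set w \<subseteq> {1..k}" "all_below (k # T) w"
    unfolding w_def using set_cancel[OF k u(1)] all_below_cancel[OF u(2,1) T] k by auto
  have v: "set v \<subseteq> {1..k}" "all_below (k # T) v"
    unfolding v_def using set_demote[OF k w(1)] all_below_demote[OF w(2)] by auto
  note cc = count_cancel[OF k, where u = u, folded c_def w_def]
  let ?c = "\<lambda>i. real (count_list u i)"
  \<comment> \<open>\<open>e1\<close> and \<open>e2\<close> are the numbers of letters 1 and
    \<open>k\<close> in the final block dropped by \<open>desub\<close>.\<close>
  define e1 where "e1 = real (count_list W 1) - (?c 0 + real (n + 1) * ?c (k - 1) + real n * ?c k)"
  define e2 where "e2 = real (count_list W k) - (?c (k - 1) + ?c k)"
  have e: "0 \<le> e1" "e1 \<le> real n" "0 \<le> e2" "e2 \<le> 1"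
  proof -
    have "real (count_list u 0 + (n + 1) * count_list u (k - 1) + n * count_list u k)
        \<le> real (count_list W 1)"
      "real (count_list W 1) \<le>
        real (count_list u 0 + (n + 1) * count_list u (k - 1) + n * count_list u k + n)"
      "real (count_list u (k - 1) + count_list u k) \<le> real (count_list W k)"
      "real (count_list W k) \<le> real (count_list u (k - 1) + count_list u k + 1)"
      using cd by (simp_all only: of_nat_le_iff)
    then show "0 \<le> e1" "e1 \<le> real n" "0 \<le> e2" "e2 \<le> 1"
      unfolding e1_def e2_def of_nat_add of_nat_mult by linarith+
  qed
  have W1: "real (count_list W 1) = ?c 0 + real (n + 1) * ?c (k - 1) + real n * ?c k + e1"
    and Wk: "real (count_list W k) = ?c (k - 1) + ?c k + e2"
    unfolding e1_def e2_def by simp_all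
  have f: "0 \<le> real n * e2" "real n * e2 \<le> real n" "0 \<le> real (n + 1) * e2" "real (n + 1) * e2 \<le> real (n + 1)"
    using e mult_left_mono[of e2 1 "real n"] mult_left_mono[of e2 1 "real (n + 1)"] by simp_all
  have dk: "real (n + 1) * real (count_list W k) - real (count_list W 1) =
      ?c k - ?c 0 + real (n + 1) * e2 - e1"
    and dk1: "real (count_list W 1) - real n * real (count_list W k) = ?c (k - 1) + ?c 0 + e1 - real n * e2"
    unfolding W1 Wk by (simp_all add: algebra_simps)
  show ?thesis
  proof (intro exI[of _ v] conjI impI v)
    assume "real (n + 1) \<le> real (n + 1) * real (count_list W k) - real (count_list W 1)"
    \<comment> \<open>The \<open>n + 1\<close> in the premise absorbs the error
      \<open>(n + 1) * e2 - e1\<close>, so \<open>u\<close> has at least as many letters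
      \<open>k\<close> as zeros. By \<open>count_cancel\<close> this is equivalent to
      \<open>c \<le> count_list w k\<close>.\<close>
    then have "?c 0 \<le> ?c k" using dk e f by linarith
    then have le: "c \<le> count_list w k" using cc(3) by simp
    note cv = count_demote[OF k le, folded v_def]
    show "\<forall>i. 1 \<le> i \<longrightarrow> i < k - 1 \<longrightarrow> count_list v i = count_list W (i + 1)"
      using cv(1) cc(1) cd by simp
    have "real (count_list v (k - 1)) = ?c (k - 1) + ?c 0" "real (count_list v k) = ?c k - ?c 0"
      using cv(2,3) cc(2,3) by linarith+
    then show "\<bar>real (count_list v (k - 1)) -
          (real (count_list W 1) - real n * real (count_list W k))\<bar> \<le> real (n + 1)"
      "\<bar>real (count_list v k) -
          (real (n + 1) * real (count_list W k) - real (count_list W 1))\<bar> \<le> real (n + 1)"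
      unfolding dk dk1 using e f by linarith+
  qed
qed

subsection \<open>Rates of words below a bound\<close>

text \<open>Normalising by an arbitrary \<open>t\<close> instead of the word lengths lets the linear map be followed by a mere
  rescaling of \<open>t\<close>.\<close>

definition approx_rate :: "nat \<Rightarrow> nat list \<Rightarrow> (nat \<Rightarrow> real) \<Rightarrow> bool" where
  "approx_rate k T \<alpha> \<longleftrightarrow> (\<exists>W t.
     (\<forall>m. set (W m) \<subseteq> {1..k} \<and> all_below T (W m)) \<and> filterlim t at_top sequentially \<and>
     (\<forall>i\<in>{1..k}. (\<lambda>m. real (count_list (W m) i) / t m) \<longlonglongrightarrow> \<alpha> i))"

lemma approx_rate_append: "approx_rate k T \<alpha> \<Longrightarrow> approx_rate k (T @ U) \<alpha>"
  unfolding approx_rate_def by (meson all_below_append)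

lemma Simplex_J:
  assumes "k \<ge> 2" "\<alpha> \<in> Simplex k"
  shows "real (J k \<alpha>) * \<alpha> k \<le> \<alpha> 1" "\<alpha> 1 < (real (J k \<alpha>) + 1) * \<alpha> k" "\<alpha> 1 < 1"
proof -
  have ak: "\<alpha> k > 0" and nn: "\<And>i. i \<in> {1..k} \<Longrightarrow> 0 \<le> \<alpha> i" and s1: "(\<Sum>i\<in>{1..k}. \<alpha> i) = 1"
    using assms by (auto simp: Simplex_def)
  have "\<alpha> 1 / \<alpha> k \<ge> 0" using nn[of 1] ak assms by simp
  then have "real (J k \<alpha>) = of_int \<lfloor>\<alpha> 1 / \<alpha> k\<rfloor>" by (simp add: J_def)
  then have "real (J k \<alpha>) \<le> \<alpha> 1 / \<alpha> k" "\<alpha> 1 / \<alpha> k < real (J k \<alpha>) + 1" by linarith+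
  then show "real (J k \<alpha>) * \<alpha> k \<le> \<alpha> 1" "\<alpha> 1 < (real (J k \<alpha>) + 1) * \<alpha> k"
    using ak by (simp_all add: field_simps)
  have "sum \<alpha> {1, k} \<le> sum \<alpha> {1..k}"
    by (rule sum_mono2) (use assms nn in auto)
  then show "\<alpha> 1 < 1" using s1 ak assms by simp
qed

lemma tendsto_close:
  fixes x y t :: "nat \<Rightarrow> real"
  assumes lim: "(\<lambda>m. y m / t m) \<longlonglongrightarrow> a" and t: "filterlim t at_top sequentially"
    and close: "\<forall>\<^sub>F m in sequentially. \<bar>x m - y m\<bar> \<le> C"
  shows "(\<lambda>m. x m / t m) \<longlonglongrightarrow> a"
proof -
  have "(\<lambda>m. C / t m) \<longlonglongrightarrow> 0" by (rule tendsto_divide_0[OF tendsto_const]) (rule filterlim_at_top_imp_at_infinity[OF t])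
  moreover have "\<forall>\<^sub>F m in sequentially. norm (x m / t m - y m / t m) \<le> C / t m"
    using close filterlim_at_top_dense[THEN iffD1, OF t, rule_format, of 0]
  proof eventually_elim
    case (elim m)
    then show ?case by (simp add: divide_right_mono flip: diff_divide_distrib)
  qed
  ultimately have "(\<lambda>m. x m / t m - y m / t m) \<longlonglongrightarrow> 0"
    by (rule Lim_null_comparison[rotated])
  from tendsto_add[OF this lim] show ?thesis by simp
qed

text \<open>Applies \<open>desub_step\<close> to each witness word. Its premise holds eventually
  because the required difference, divided by \<open>t\<close>, has a positive limit; the bounded
  errors vanish in the limit, and the factor \<open>1 - \<alpha> 1\<close> becomes a rescaling of
  \<open>t\<close>.\<close>

lemma approx_rate_step:
  assumes k: "k \<ge> 2" and a: "\<alpha> \<in> Simplex k" and T: "set T \<subseteq> {1..k}"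
    and ar: "approx_rate k (subst_word k (J k \<alpha>) (k # T)) \<alpha>"
  shows "approx_rate k (k # T) (K_map k \<alpha>)"
proof -
  define n where "n = J k \<alpha>"
  define \<mu> where "\<mu> = 1 - \<alpha> 1"
  have \<mu>: "\<mu> > 0" using Simplex_J[OF k a] by (simp add: \<mu>_def)
  from ar obtain W t where W: "\<And>m. set (W m) \<subseteq> {1..k}"
      "\<And>m. all_below (subst_word k n (k # T)) (W m)"
    and t: "filterlim t at_top sequentially"
    and lim: "\<And>i. i \<in> {1..k} \<Longrightarrow> (\<lambda>m. real (count_list (W m) i) / t m) \<longlonglongrightarrow> \<alpha> i"
    unfolding approx_rate_def n_def by blast
  let ?c = "\<lambda>m i. real (count_list (W m) i)"
  let ?x = "\<lambda>m. ?c m 1 - real n * ?c m k" and ?y = "\<lambda>m. real (n + 1) * ?c m k - ?c m 1"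
  from desub_step[OF k W(1) T W(2)] obtain v where
    v: "\<And>m. set (v m) \<subseteq> {1..k}" "\<And>m. all_below (k # T) (v m)"
    and vc: "\<And>m. real (n + 1) \<le> ?y m \<Longrightarrow>
      (\<forall>i. 1 \<le> i \<longrightarrow> i < k - 1 \<longrightarrow> count_list (v m) i = count_list (W m) (i + 1)) \<and>
      \<bar>real (count_list (v m) (k - 1)) - ?x m\<bar> \<le> real (n + 1) \<and>
      \<bar>real (count_list (v m) k) - ?y m\<bar> \<le> real (n + 1)"
    by metis
  have x: "(\<lambda>m. ?x m / t m) \<longlonglongrightarrow> \<alpha> 1 - real n * \<alpha> k"
    using tendsto_diff[OF lim[of 1] tendsto_mult[OF tendsto_const[of "real n"] lim[of k]]] k
    by (simp add: diff_divide_distrib)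
  have y: "(\<lambda>m. ?y m / t m) \<longlonglongrightarrow> real (n + 1) * \<alpha> k - \<alpha> 1"
    using tendsto_diff[OF tendsto_mult[OF tendsto_const[of "real (n + 1)"] lim[of k]] lim[of 1]] k
    by (simp add: diff_divide_distrib)
  have "real (n + 1) * \<alpha> k - \<alpha> 1 > 0"
    using Simplex_J(2)[OF k a] by (simp add: n_def add.commute)
  then have "filterlim (\<lambda>m. ?y m / t m * t m) at_top sequentially"
    by (rule filterlim_tendsto_pos_mult_at_top[OF y _ t])
  then have "\<forall>\<^sub>F m in sequentially. real (n + 1) \<le> ?y m / t m * t m"
    by (simp only: filterlim_at_top)
  with filterlim_at_top_dense[THEN iffD1, OF t, rule_format, of 0]
  have ev: "\<forall>\<^sub>F m in sequentially. real (n + 1) \<le> ?y m"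
    by eventually_elim simp
  have s: "filterlim (\<lambda>m. \<mu> * t m) at_top sequentially"
    by (rule filterlim_tendsto_pos_mult_at_top[OF tendsto_const \<mu> t])
  have "(\<lambda>m. real (count_list (v m) i) / (\<mu> * t m)) \<longlonglongrightarrow> K_map k \<alpha> i" if i: "i \<in> {1..k}" for i
  proof -
    have red: "(\<lambda>m. real (count_list (v m) i) / (\<mu> * t m)) \<longlonglongrightarrow> b / \<mu>"
      if "(\<lambda>m. real (count_list (v m) i) / t m) \<longlonglongrightarrow> b" for b
      using tendsto_divide[OF that tendsto_const[of \<mu>]] \<mu> by (simp add: mult.commute)
    consider "i = k" | "i = k - 1" | "1 \<le> i" "i < k - 1" using i by fastforce
    then show ?thesis
    proof cases
      case 1
      have "(\<lambda>m. real (count_list (v m) k) / t m) \<longlonglongrightarrow> real (n + 1) * \<alpha> k - \<alpha> 1"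
        by (rule tendsto_close[OF y t eventually_mono[OF ev]]) (use vc in blast)
      from red[unfolded 1, OF this] 1 show ?thesis
        by (simp add: K_map_def K_branch_def n_def \<mu>_def)
    next
      case 2
      have "(\<lambda>m. real (count_list (v m) (k - 1)) / t m) \<longlonglongrightarrow> \<alpha> 1 - real n * \<alpha> k"
        by (rule tendsto_close[OF x t eventually_mono[OF ev]]) (use vc in blast)
      from red[unfolded 2, OF this] 2 k show ?thesis
        by (auto simp: K_map_def K_branch_def n_def \<mu>_def)
    next
      case 3
      have "(\<lambda>m. real (count_list (v m) i) / t m) \<longlonglongrightarrow> \<alpha> (i + 1)"
        by (rule tendsto_close[OF lim[of "i + 1"] t eventually_mono[OF ev], of _ 0])
          (use vc 3 in auto)
      from red[OF this] 3 k show ?thesis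
        by (auto simp: K_map_def K_branch_def n_def \<mu>_def)
    qed
  qed
  then show ?thesis unfolding approx_rate_def using v s by blast
qed

lemma approx_rate_bounded:
  assumes "approx_rate k T \<alpha>" "1 \<le> k"
    and bd: "\<And>V. set V \<subseteq> {1..k} \<Longrightarrow> all_below T V \<Longrightarrow> count_list V k \<le> 1"
  shows "\<alpha> k = 0"
proof -
  from assms(1,2) obtain W t where W: "\<And>m. set (W m) \<subseteq> {1..k}" "\<And>m. all_below T (W m)"
    and t: "filterlim t at_top sequentially"
    and lim: "(\<lambda>m. real (count_list (W m) k) / t m) \<longlonglongrightarrow> \<alpha> k"
    unfolding approx_rate_def by fastforce
  have "(\<lambda>m. real (count_list (W m) k) / t m) \<longlonglongrightarrow> 0"
    by (rule tendsto_close[OF _ t, of "\<lambda>_. 0" _ _ 1]) (use bd[OF W] in auto)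
  with lim show ?thesis by (blast intro: LIMSEQ_unique)
qed

text \<open>A proper extension of the bound is not below it, so a letter \<open>k\<close> can be
  followed by at most one letter, a 1. Hence a word with all suffixes below \<open>[k, 1]\<close>
  contains at most one \<open>k\<close>.\<close>

lemma approx_rate_single:
  assumes "k \<ge> 2" "approx_rate k [k] \<alpha> \<or> approx_rate k [k, 1] \<alpha>"
  shows "\<alpha> k = 0"
proof -
  have "count_list V k \<le> 1" if "set V \<subseteq> {1..k}" "all_below [k, 1] V" for V
    using that
  proof (induction V)
    case (Cons x V)
    have "V = [] \<or> (\<exists>y. V = [y]) \<or> (\<exists>y z V'. V = y # z # V')"
      by (metis neq_Nil_conv)
    with Cons \<open>k \<ge> 2\<close> show ?case by auto
  qed simp
  moreover have "approx_rate k [k, 1] \<alpha>" using assms(2) approx_rate_append[of k "[k]" \<alpha> "[1]"] by auto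
  ultimately show ?thesis using \<open>k \<ge> 2\<close> approx_rate_bounded[of k "[k, 1]"] by simp
qed

lemma Simplex_pos: "\<alpha> \<in> Simplex k \<Longrightarrow> 0 < \<alpha> k"
  by (simp add: Simplex_def)

lemma K_iter_in_Simplex:
  assumes "k \<ge> 2" "\<alpha> \<in> Simplex k"
  shows "(K_map k ^^ r) \<alpha> \<in> Simplex k"
  using assms by (induction r) (auto intro: K_map_in_Simplex)

lemma subst_word_0_replicate: "subst_word k 0 (replicate a k) = replicate a k"
  by (induction a) (auto simp: subst_letter_def)

lemma itinerary_K_map: "itinerary k (K_map k \<alpha>) r = itinerary k \<alpha> (Suc r)"
  by (simp add: itinerary_def funpow_swap1)

text \<open>Every step with itinerary 0 lowers the last letter of the bound by one, and a last letter 1 is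
  absorbed by the preceding \<open>k\<close>.\<close>

lemma zero_itinerary_approx_rate:
  assumes "k \<ge> 2" "\<beta> \<in> Simplex k" "\<And>r. itinerary k \<beta> r = 0"
    and "1 \<le> j" "j < k" "approx_rate k (replicate (Suc a) k @ [j]) \<beta>"
  shows False
  using assms(2-)
proof (induction a arbitrary: j \<beta>)
  case 0
  then show ?case
  proof (induction j arbitrary: \<beta>)
    case (Suc j)
    show ?case
    proof (cases "j = 0")
      case True
      with Suc approx_rate_single[of k \<beta>] Simplex_pos[of \<beta> k] \<open>k \<ge> 2\<close> show ?thesis by simp
    next
      case False
      have J: "J k \<beta> = 0" using Suc.prems(2)[of 0] by (simp add: itinerary_def)
      have "subst_word k 0 (k # [j]) = [k, Suc j]"
        using False Suc.prems by (auto simp: subst_letter_def)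
      then have "approx_rate k (k # [j]) (K_map k \<beta>)"
        using approx_rate_step[OF \<open>k \<ge> 2\<close> Suc.prems(1), of "[j]"] J False Suc.prems by simp
      with Suc.IH[of "K_map k \<beta>"] Suc.prems False \<open>k \<ge> 2\<close> show ?thesis
        by (simp add: itinerary_K_map K_map_in_Simplex)
    qed
  qed simp
next
  case (Suc a)
  note IH = Suc.IH
  from Suc.prems show ?case
  proof (induction j arbitrary: \<beta>)
    case (Suc j)
    have J: "J k \<beta> = 0" using Suc.prems(2)[of 0] by (simp add: itinerary_def)
    have K: "K_map k \<beta> \<in> Simplex k" using K_map_in_Simplex[OF \<open>k \<ge> 2\<close> Suc.prems(1)] .
    show ?case
    proof (cases "j = 0")
      case True
      \<comment> \<open>\<open>\<Lambda>\<^sub>0\<close> maps \<open>k - 1\<close> to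
        \<open>k\<close> followed by 1, so the last two letters desubstitute to
        \<open>k - 1\<close>: the run of \<open>k\<close> gets shorter by one, and the last letter
        starts again at \<open>k - 1\<close>.\<close>
      have "subst_word k 0 (k # replicate a k @ [k - 1]) = replicate (Suc (Suc a)) k @ [Suc j]"
        using True \<open>k \<ge> 2\<close>
        by (auto simp: subst_letter_def subst_word_0_replicate replicate_append_same simp flip: replicate_app_Cons_same)
      then have "approx_rate k (k # replicate a k @ [k - 1]) (K_map k \<beta>)"
        using J Suc.prems(5) \<open>k \<ge> 2\<close>
        by (intro approx_rate_step[OF \<open>k \<ge> 2\<close> Suc.prems(1)]) (auto simp: set_replicate_conv_if)
      then show ?thesis
        using \<open>k \<ge> 2\<close> Suc.prems(2) by (intro IH[OF K, of "k - 1"]) (auto simp: itinerary_K_map)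
    next
      case False
      have "subst_word k 0 (k # replicate (Suc a) k @ [j]) = replicate (Suc (Suc a)) k @ [Suc j]"
        using False Suc.prems by (auto simp: subst_letter_def subst_word_0_replicate)
      then have "approx_rate k (k # replicate (Suc a) k @ [j]) (K_map k \<beta>)"
        using J Suc.prems(4,5) False
        by (intro approx_rate_step[OF \<open>k \<ge> 2\<close> Suc.prems(1)]) (auto simp: set_replicate_conv_if)
      with Suc.IH[of "K_map k \<beta>"] Suc.prems False K show ?thesis
        by (simp add: itinerary_K_map)
    qed
  qed simp
qed

lemma subst_word_Cons_k:
  assumes "k \<ge> 2" "set T \<subseteq> {1..k}"
  obtains T' where "subst_word k n (k # T) = k # T'" "set T' \<subseteq> {1..k}"
  using set_subst_word[of k "k # T" n] assms by (simp add: subst_letter_def)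

text \<open>The substitutions are stripped from the outside inwards, with one application of
  \<open>K_map\<close> each. Every intermediate bound still starts with \<open>k\<close>, as
  \<open>approx_rate_step\<close> demands.\<close>

lemma approx_rate_iterate:
  assumes k: "k \<ge> 2" and a: "\<alpha> \<in> Simplex k" and T: "set T \<subseteq> {1..k}"
    and "approx_rate k (subst_comp k (itinerary k \<alpha>) r (k # T)) \<alpha>"
  shows "approx_rate k (k # T) ((K_map k ^^ Suc r) \<alpha>)"
  using T assms(4)
proof (induction r arbitrary: T)
  case 0
  then show ?case using approx_rate_step[OF k a] by (simp add: itinerary_def)
next
  case (Suc r)
  obtain T' where T': "subst_word k (itinerary k \<alpha> (Suc r)) (k # T) = k # T'" "set T' \<subseteq> {1..k}"
    using subst_word_Cons_k[OF k Suc.prems(1)] .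
  have "approx_rate k (subst_word k (itinerary k \<alpha> (Suc r)) (k # T)) ((K_map k ^^ Suc r) \<alpha>)"
    using Suc.IH[OF T'(2)] Suc.prems(2) by (simp only: T'(1) subst_comp.simps o_apply)
  then show ?case
    using approx_rate_step[OF k K_iter_in_Simplex[OF k a] Suc.prems(1), of "Suc r"]
    by (simp add: itinerary_def)
qed

section \<open>Prefixes of maximal sequences and the lower bound\<close>

lemma lex_linear:
  assumes "\<not> lex_le v w"
  obtains p where "w p < v p" "\<And>q. q < p \<Longrightarrow> w q = v q"
proof -
  have ne: "\<exists>p. w p \<noteq> v p" using assms unfolding lex_le_def by auto
  define p where "p = (LEAST p. w p \<noteq> v p)"
  have p: "w p \<noteq> v p" unfolding p_def using ne by (rule LeastI_ex)
  have eq: "w q = v q" if "q < p" for q using not_less_Least[OF that[unfolded p_def]] by simp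
  have "\<not> v p < w p"
  proof
    assume "v p < w p"
    with eq have "less_fun v w" unfolding less_fun_def by (intro exI[of _ p]) simp
    with assms show False by (simp add: lex_le_def)
  qed
  with p eq show ?thesis using that[of p] by simp
qed

lemma lex_leI:
  assumes "w p < v p" "\<And>q. q < p \<Longrightarrow> w q = v q"
  shows "lex_le w v"
  using assms unfolding lex_le_def less_fun_def by auto

lemma shift_funpow: "(shift ^^ r) w q = w (r + q)"
  by (induction r arbitrary: w) (simp_all add: funpow_swap1 shift_def)

lemma initial_word_Suc: "initial_word w (Suc m) = w 0 # initial_word (shift w) m"
  unfolding initial_word_def shift_def by (simp add: map_upt_Suc del: upt_Suc)

lemma S_seq_agrees:
  obtains R where "\<And>r q. r \<ge> R \<Longrightarrow> q \<le> p \<Longrightarrow> periodic_seq (subst_comp k ns r [k]) q = S_seq k ns q"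
proof -
  have "\<forall>\<^sub>F r in sequentially. periodic_seq (subst_comp k ns r [k]) q = S_seq k ns q" for q
    using periodic_seq_subst_comp_tendsto[of k ns] unfolding seq_tendsto_iff tendsto_discrete by blast
  then have "\<forall>\<^sub>F r in sequentially. \<forall>q\<in>{..p}. periodic_seq (subst_comp k ns r [k]) q = S_seq k ns q"
    by (intro eventually_ball_finite) auto
  then show ?thesis unfolding eventually_sequentially using that by auto
qed

lemma subst_comp_replicate:
  "subst_comp k ns r (replicate m k) = concat (replicate m (subst_comp k ns r [k]))"
proof (induction m)
  case 0
  show ?case using subst_comp_append[of k ns r "[]" "[]"] by simp
next
  case (Suc m)
  then show ?case using subst_comp_append[of k ns r "[k]" "replicate m k"] by simp
qed

lemma nth_concat_replicate:
  assumes "W \<noteq> []" "q < m * length W"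
  shows "concat (replicate m W) ! q = periodic_seq W q"
  using assms(2)
proof (induction m arbitrary: q)
  case (Suc m)
  show ?case
  proof (cases "q < length W")
    case False
    then have "q mod length W = (q - length W) mod length W" by (simp add: le_mod_geq)
    with Suc False show ?thesis by (simp add: nth_append periodic_seq_def)
  qed (simp add: nth_append periodic_seq_def)
qed simp

lemma length_concat_replicate: "length (concat (replicate m W)) = m * length W"
  by (induction m) auto

lemma below_initial_word:
  assumes "p < length T" "f p < T ! p" "\<And>q. q < p \<Longrightarrow> f q = T ! q"
  shows "below (initial_word f m) T"
  using assms
proof (induction T arbitrary: f m p)
  case (Cons y T)
  show ?case
  proof (cases m)
    case (Suc m')
    show ?thesis
    proof (cases p)
      case 0
      with Cons Suc show ?thesis by (simp add: initial_word_Suc)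
    next
      case (Suc p')
      have "below (initial_word (shift f) m') T"
        using Cons.prems Suc by (intro Cons.IH[of p']) (auto simp: shift_def)
      with Cons.prems(3)[of 0] Suc \<open>m = Suc m'\<close> show ?thesis by (simp add: initial_word_Suc)
    qed
  qed (simp add: initial_word_def)
qed simp

text \<open>The sequence \<open>f\<close> stands for an arbitrary shift of \<open>w\<close>, so that
  the induction can remove its first letter while \<open>w\<close> stays fixed.\<close>

lemma all_below_initial_word:
  assumes "p < length T" "w p < T ! p" "\<And>q. q < p \<Longrightarrow> w q = T ! q"
    and "\<And>r. lex_le ((shift ^^ r) f) w"
  shows "all_below T (initial_word f m)"
  using assms(4)
proof (induction m arbitrary: f)
  case 0
  then show ?case by (simp add: initial_word_def)
next
  case (Suc m)
  have "lex_le ((shift ^^ r) (shift f)) w" for r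
    using Suc.prems[of "Suc r"] by (simp add: funpow_swap1)
  then have "all_below T (initial_word (shift f) m)" by (rule Suc.IH)
  moreover have "below (initial_word f (Suc m)) T"
  proof -
    from Suc.prems[of 0] consider "f = w" | p' where "f p' < w p'" "\<And>q. q < p' \<Longrightarrow> f q = w q"
      unfolding lex_le_def less_fun_def by auto
    then show ?thesis
    proof cases
      case 1
      with assms show ?thesis by (auto intro: below_initial_word)
    next
      case 2
      \<comment> \<open>Before the first place where \<open>f\<close> or \<open>T\<close> departs
        from \<open>w\<close> all three agree; at that place \<open>f\<close> is less than
        \<open>T\<close>.\<close>
      let ?q = "min p p'"
      have "f ?q < T ! ?q" "\<And>q. q < ?q \<Longrightarrow> f q = T ! q"
        using 2 assms(2,3) by (cases p p' rule: linorder_cases; simp)+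
      with assms(1) show ?thesis by (intro below_initial_word[of ?q]) auto
    qed
  qed
  ultimately show ?case by (simp add: initial_word_Suc)
qed

lemma length_subst_comp_ge: "length W \<le> length (subst_comp k ns r W)"
proof (induction r arbitrary: W)
  case 0
  show ?case by (induction W) (auto simp: subst_letter_def)
next
  case (Suc r)
  have "length W \<le> length (subst_word k n W)" for n
    by (induction W) (auto simp: subst_letter_def)
  with Suc show ?case by (auto intro: order_trans)
qed

text \<open>Each later index with a positive entry n lengthens the word, because
  \<open>\<Lambda>\<^sub>n(k)\<close> then has letters after \<open>k\<close> and no substitution
  erases them.\<close>

lemma length_subst_comp_unbounded:
  assumes "\<forall>r. \<exists>r'>r. ns r' > 0"
  shows "\<exists>r. N \<le> length (subst_comp k ns r [k])"
proof (induction N)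
  case (Suc N)
  then obtain r where r: "N \<le> length (subst_comp k ns r [k])" by blast
  obtain r' where r': "r' > r" "ns r' > 0" using assms by blast
  then obtain s where s: "r' = Suc s" "s \<ge> r" by (cases r') auto
  define V where "V = replicate (ns r') (1::nat)"
  have "length (subst_comp k ns r [k]) \<le> length (subst_comp k ns s [k])"
    using subst_comp_prefix_le[OF s(2), of k ns] by auto
  moreover have "subst_comp k ns r' [k] = subst_comp k ns s [k] @ subst_comp k ns s V"
    using subst_comp_append[of k ns s "[k]" V] s(1) by (simp add: subst_letter_def V_def)
  moreover have "0 < length (subst_comp k ns s V)"
    using length_subst_comp_ge[of V k ns s] r'(2) unfolding V_def length_replicate by linarith
  ultimately have "Suc N \<le> length (subst_comp k ns r' [k])" using r
    by (simp add: length_greater_0_conv[symmetric] del: length_greater_0_conv)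
  then show ?case by blast
qed simp

lemma maximal_approx_rate:
  assumes "k \<ge> 2" "w \<in> maximal_rate_seqs k \<alpha>"
    and "p < length T" "w p < T ! p" "\<And>q. q < p \<Longrightarrow> w q = T ! q"
  shows "approx_rate k T \<alpha>"
proof -
  have w: "w \<in> seqs k" "\<And>r. lex_le ((shift ^^ r) w) w"
    "\<And>i. i \<in> {1..k} \<Longrightarrow> (\<lambda>r. freq (initial_word w r) i) \<longlonglongrightarrow> \<alpha> i"
    using assms(2) by (auto simp: maximal_rate_seqs_def maximal_seqs_def rate_seqs_def)
  have "set (initial_word w m) \<subseteq> {1..k}" for m
    using w(1) by (auto simp: initial_word_def seqs_def alphabet_def)
  moreover have "all_below T (initial_word w m)" for m
    by (rule all_below_initial_word[OF assms(3-5) w(2)])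
  ultimately show ?thesis
    unfolding approx_rate_def using w(3) filterlim_real_sequentially
    by (intro exI[of _ "initial_word w"] exI[of _ real]) (auto simp: freq_def initial_word_def)
qed

text \<open>For a smaller \<open>w\<close>, the first difference lies inside the image of some power
  of \<open>k\<close>, and desubstitution leaves that power as the bound. If infinitely many
  itinerary entries are positive, the images grow and a single \<open>k\<close> suffices,
  contradicting its positive frequency. Otherwise the itinerary ends in zeros and
  \<open>zero_itinerary_approx_rate\<close> applies.\<close>

lemma S_seq_lower_bound:
  assumes k: "k \<ge> 2" and a: "\<alpha> \<in> Simplex k" and w: "w \<in> maximal_rate_seqs k \<alpha>"
  shows "lex_le (S_seq k (itinerary k \<alpha>)) w"
proof (rule ccontr)
  let ?ns = "itinerary k \<alpha>" and ?W = "\<lambda>r. subst_comp k (itinerary k \<alpha>) r [k]"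
  assume "\<not> ?thesis"
  then obtain p where p: "w p < S_seq k ?ns p" "\<And>q. q < p \<Longrightarrow> w q = S_seq k ?ns q"
    by (rule lex_linear) blast
  obtain R where R: "\<And>r q. r \<ge> R \<Longrightarrow> q \<le> p \<Longrightarrow> periodic_seq (?W r) q = S_seq k ?ns q"
    using S_seq_agrees[of p k ?ns] by blast
  have key: "approx_rate k (replicate (Suc m) k) ((K_map k ^^ Suc r) \<alpha>)"
    if r: "r \<ge> R" and m: "p < Suc m * length (?W r)" for r m
  proof -
    have nth: "subst_comp k ?ns r (replicate (Suc m) k) ! q = S_seq k ?ns q" if "q \<le> p" for q
      using R[OF r that] nth_concat_replicate[OF subst_comp_nonempty, of q "Suc m" k ?ns r] m that
      unfolding subst_comp_replicate by simp
    have "approx_rate k (subst_comp k ?ns r (replicate (Suc m) k)) \<alpha>"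
    proof (rule maximal_approx_rate[OF k w])
      show "p < length (subst_comp k ?ns r (replicate (Suc m) k))"
        unfolding subst_comp_replicate length_concat_replicate by (rule m)
    qed (use nth p in auto)
    then show ?thesis
      using approx_rate_iterate[OF k a, of "replicate m k" r] k by (simp add: set_replicate_conv_if)
  qed
  have S: "(K_map k ^^ Suc r) \<alpha> \<in> Simplex k" for r by (rule K_iter_in_Simplex[OF k a])
  show False
  proof (cases "\<forall>r. \<exists>r'>r. ?ns r' > 0")
    case True
    then obtain r0 where r0: "Suc p \<le> length (?W r0)" using length_subst_comp_unbounded by blast
    define r where "r = max r0 R"
    obtain V where "?W r = ?W r0 @ V" using subst_comp_prefix_le[of r0 r k ?ns] by (auto simp: r_def)
    with r0 have "p < Suc 0 * length (?W r)" by simp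
    from key[OF _ this] have "approx_rate k [k] ((K_map k ^^ Suc r) \<alpha>)" by (simp add: r_def)
    with approx_rate_single[OF k] Simplex_pos[OF S[of r]] show False by fastforce
  next
    case False
    then obtain r0 where r0: "\<And>r. r > r0 \<Longrightarrow> ?ns r = 0" by auto
    define r where "r = max r0 R"
    define \<beta> where "\<beta> = (K_map k ^^ Suc r) \<alpha>"
    have it: "itinerary k \<beta> s = 0" for s
    proof -
      have "itinerary k \<beta> s = ?ns (s + Suc r)"
        unfolding itinerary_def \<beta>_def by (simp only: funpow_add o_apply)
      then show ?thesis using r0[of "s + Suc r"] by (simp add: r_def)
    qed
    have "0 < length (?W r)" using subst_comp_nonempty[of k ?ns r] by simp
    then have "p < Suc p * length (?W r)" by (cases "length (?W r)") auto
    from key[OF _ this] have "approx_rate k (replicate (Suc p) k) \<beta>" by (simp add: r_def \<beta>_def)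
    \<comment> \<open>Appending 1 only weakens the bound and gives it the form that
      \<open>zero_itinerary_approx_rate\<close> expects.\<close>
    then have "approx_rate k (replicate (Suc p) k @ [1]) \<beta>" by (rule approx_rate_append)
    with zero_itinerary_approx_rate[OF k, of \<beta> 1 p] S[of r] it k show False by (simp add: \<beta>_def)
  qed
qed

subsection \<open>Substitution of infinite sequences\<close>

text \<open>Images of letters are non-empty, so the image of the first \<open>Suc j\<close> letters
  reaches position \<open>j\<close>.\<close>

definition sub_seq :: "nat \<Rightarrow> nat \<Rightarrow> (nat \<Rightarrow> nat) \<Rightarrow> nat \<Rightarrow> nat" where
  "sub_seq k n w j = subst_word k n (initial_word w (Suc j)) ! j"

lemma length_subst_word_ge: "length W \<le> length (subst_word k n W)"
  by (induction W) (auto simp: subst_letter_def)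

lemma length_initial_word [simp]: "length (initial_word w m) = m"
  by (simp add: initial_word_def)

lemma nth_initial_word [simp]: "q < m \<Longrightarrow> initial_word w m ! q = w q"
  by (simp add: initial_word_def)

lemma initial_word_0 [simp]: "initial_word w 0 = []"
  by (simp add: initial_word_def)

lemma initial_word_snoc: "initial_word w (Suc m) = initial_word w m @ [w m]"
  by (simp add: initial_word_def)

lemma set_initial_word: "w \<in> seqs k \<Longrightarrow> set (initial_word w m) \<subseteq> {1..k}"
  by (auto simp: initial_word_def seqs_def alphabet_def)

lemma initial_word_append:
  "initial_word w (m + d) = initial_word w m @ map w [m..<m + d]"
  unfolding initial_word_def using upt_add_eq_append[of 0 m d] by simp

lemma sub_seq_nth:
  assumes "j < length (subst_word k n (initial_word w m))"
  shows "subst_word k n (initial_word w m) ! j = sub_seq k n w j"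
proof -
  have j: "j < length (subst_word k n (initial_word w (Suc j)))"
    using length_subst_word_ge[of "initial_word w (Suc j)" k n] by simp
  consider d where "Suc j = m + d" | d where "m = Suc j + d"
    by (metis le_add_diff_inverse nat_le_linear)
  then show ?thesis
  proof cases
    case 1
    then show ?thesis
      unfolding sub_seq_def 1 initial_word_append using assms by (simp add: nth_append)
  next
    case 2
    show ?thesis
      unfolding sub_seq_def 2 initial_word_append using j by (simp add: nth_append)
  qed
qed

lemma sub_seq_unfold:
  "sub_seq k n w j =
    (if j < length (subst_letter k n (w 0)) then subst_letter k n (w 0) ! j
     else sub_seq k n (shift w) (j - length (subst_letter k n (w 0))))"
proof -
  let ?V = "subst_word k n (initial_word (shift w) (Suc j))"
  have V: "Suc j \<le> length ?V"
    using length_subst_word_ge[of "initial_word (shift w) (Suc j)" k n] by simp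
  have e: "subst_word k n (initial_word w (Suc (Suc j))) = subst_letter k n (w 0) @ ?V"
    by (subst initial_word_Suc) simp
  have "sub_seq k n w j = (subst_letter k n (w 0) @ ?V) ! j"
    using sub_seq_nth[of j k n w "Suc (Suc j)"] V unfolding e by simp
  also have "\<dots> = (if j < length (subst_letter k n (w 0)) then subst_letter k n (w 0) ! j
     else ?V ! (j - length (subst_letter k n (w 0))))"
    by (simp add: nth_append)
  also have "?V ! (j - length (subst_letter k n (w 0))) =
      sub_seq k n (shift w) (j - length (subst_letter k n (w 0)))"
    using V by (intro sub_seq_nth) simp
  finally show ?thesis .
qed

lemma sub_seq_beyond:
  "sub_seq k n w (length (subst_letter k n (w 0)) + j) = sub_seq k n (shift w) j"
  by (subst sub_seq_unfold) simp

lemma length_subst_letter: "0 < length (subst_letter k n i)" "length (subst_letter k n i) \<le> n + 2"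
  by (auto simp: subst_letter_def)

lemma shift_seqs: "w \<in> seqs k \<Longrightarrow> shift w \<in> seqs k"
  by (simp add: seqs_def shift_def)

lemma shift_funpow_seqs: "w \<in> seqs k \<Longrightarrow> (shift ^^ r) w \<in> seqs k"
  by (simp add: seqs_def shift_funpow)

lemma sub_seq_0_ge: "k \<ge> 2 \<Longrightarrow> w \<in> seqs k \<Longrightarrow> 2 \<le> sub_seq k n w 0"
  by (subst sub_seq_unfold) (auto simp: subst_letter_def seqs_def alphabet_def Suc_le_eq)

lemma sub_seq_in_seqs:
  assumes "k \<ge> 2" "w \<in> seqs k"
  shows "sub_seq k n w \<in> seqs k"
proof -
  have "sub_seq k n w j \<in> {1..k}" for j
  proof -
    have "j < length (subst_word k n (initial_word w (Suc j)))"
      using length_subst_word_ge[of "initial_word w (Suc j)" k n] by simp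
    then have "sub_seq k n w j \<in> set (subst_word k n (initial_word w (Suc j)))"
      unfolding sub_seq_def by (rule nth_mem)
    with set_subst_word[OF assms(1) set_initial_word[OF assms(2)]] show ?thesis by blast
  qed
  then show ?thesis by (simp add: seqs_def alphabet_def)
qed

lemma sub_seq_less:
  assumes k: "k \<ge> 2" and "v \<in> seqs k" "w \<in> seqs k" "v p < w p" "\<And>q. q < p \<Longrightarrow> v q = w q"
  shows "\<exists>p. sub_seq k n v p < sub_seq k n w p \<and> (\<forall>q<p. sub_seq k n v q = sub_seq k n w q)"
  using assms(2-)
proof (induction p arbitrary: v w)
  case 0
  have vw: "1 \<le> v 0" "v 0 < w 0" "w 0 \<le> k" using 0 by (auto simp: seqs_def alphabet_def)
  show ?case
  proof (cases "v 0 = k - 1")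
    case True
    with vw have w0: "w 0 = k" by simp
    have v: "subst_letter k n (v 0) = k # replicate (Suc n) 1" using True k by (simp add: subst_letter_def)
    have w: "subst_letter k n (w 0) = k # replicate n 1" using w0 by (simp add: subst_letter_def)
    have V: "sub_seq k n v q = (k # replicate (Suc n) 1) ! q" if "q < n + 2" for q
      using that by (subst sub_seq_unfold) (simp add: v)
    have W: "sub_seq k n w q = (k # replicate n 1) ! q" if "q < n + 1" for q
      using that by (subst sub_seq_unfold) (simp add: w)
    have "sub_seq k n w (n + 1) = sub_seq k n (shift w) 0"
      using sub_seq_beyond[of k n w 0] by (simp add: w)
    moreover have "sub_seq k n v (n + 1) = 1" using V[of "n + 1"] by (simp del: replicate.simps)
    ultimately have "sub_seq k n v (n + 1) < sub_seq k n w (n + 1)"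
      using sub_seq_0_ge[OF k shift_seqs[OF 0(2)], of n] by simp
    moreover have "sub_seq k n v q = sub_seq k n w q" if "q < n + 1" for q
      using that V[of q] W[of q] by (cases q) (auto simp del: replicate.simps)
    ultimately show ?thesis by blast
  next
    case False
    then have "sub_seq k n v 0 = v 0 + 1"
      using vw by (subst sub_seq_unfold) (auto simp: subst_letter_def)
    moreover have "sub_seq k n w 0 = k \<or> sub_seq k n w 0 = w 0 + 1"
      by (subst (1 2) sub_seq_unfold) (auto simp: subst_letter_def)
    ultimately have "sub_seq k n v 0 < sub_seq k n w 0" using vw False by linarith
    then show ?thesis by auto
  qed
next
  case (Suc p)
  have e: "v 0 = w 0" using Suc.prems(4)[of 0] by simp
  obtain p' where p': "sub_seq k n (shift v) p' < sub_seq k n (shift w) p'"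
    "\<forall>q<p'. sub_seq k n (shift v) q = sub_seq k n (shift w) q"
    using Suc.IH[of "shift v" "shift w"] Suc.prems by (auto simp: shift_seqs) (auto simp: shift_def)
  let ?l = "length (subst_letter k n (w 0))"
  have "sub_seq k n v (?l + p') < sub_seq k n w (?l + p')"
    using p'(1) sub_seq_beyond[of k n v p'] sub_seq_beyond[of k n w p'] e by simp
  moreover have "sub_seq k n v q = sub_seq k n w q" if "q < ?l + p'" for q
    using that p'(2) by (subst (1 2) sub_seq_unfold) (auto simp: e)
  ultimately show ?case by blast
qed

lemma sub_seq_lex_le:
  assumes "k \<ge> 2" "v \<in> seqs k" "w \<in> seqs k" "lex_le v w"
  shows "lex_le (sub_seq k n v) (sub_seq k n w)"
proof (cases "v = w")
  case True
  then show ?thesis by (simp add: lex_le_def)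
next
  case False
  with assms(4) obtain p where "v p < w p" "\<And>q. q < p \<Longrightarrow> v q = w q"
    unfolding lex_le_def less_fun_def by auto
  with sub_seq_less[OF assms(1-3)] show ?thesis
    unfolding lex_le_def less_fun_def by blast
qed

lemma shift_sub_seq:
  "\<exists>i d. (shift ^^ r) (sub_seq k n w) = (shift ^^ d) (sub_seq k n ((shift ^^ i) w)) \<and>
     d < length (subst_letter k n (w i))"
proof (induction r)
  case 0
  show ?case using length_subst_letter(1) by (intro exI[of _ 0]) simp
next
  case (Suc r)
  then obtain i d where id: "(shift ^^ r) (sub_seq k n w) = (shift ^^ d) (sub_seq k n ((shift ^^ i) w))"
     "d < length (subst_letter k n (w i))" by blast
  then have s: "(shift ^^ Suc r) (sub_seq k n w) = (shift ^^ Suc d) (sub_seq k n ((shift ^^ i) w))"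
    by simp
  show ?case
  proof (cases "Suc d < length (subst_letter k n (w i))")
    case True
    with s show ?thesis by blast
  next
    case False
    with id have d: "Suc d = length (subst_letter k n (((shift ^^ i) w) 0))"
      by (simp add: shift_funpow)
    have "(shift ^^ Suc d) (sub_seq k n ((shift ^^ i) w)) = sub_seq k n (shift ((shift ^^ i) w))"
      unfolding d by (rule ext) (simp add: shift_funpow[of "length _"] sub_seq_beyond)
    with s have "(shift ^^ Suc r) (sub_seq k n w) = (shift ^^ 0) (sub_seq k n ((shift ^^ Suc i) w))"
      by simp
    with length_subst_letter(1) show ?thesis by blast
  qed
qed

text \<open>A shift to the start of an image is itself the image of a shift of \<open>w\<close>, so
  monotonicity applies. A shift into the interior of an image starts with 1, while
  \<open>sub_seq k n w\<close> starts with a letter at least 2.\<close>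

lemma sub_seq_maximal:
  assumes k: "k \<ge> 2" and w: "w \<in> maximal_seqs k"
  shows "sub_seq k n w \<in> maximal_seqs k"
proof -
  have ws: "w \<in> seqs k" and wm: "\<And>r. lex_le ((shift ^^ r) w) w"
    using w by (auto simp: maximal_seqs_def)
  have "lex_le ((shift ^^ r) (sub_seq k n w)) (sub_seq k n w)" for r
  proof -
    obtain i d where id: "(shift ^^ r) (sub_seq k n w) = (shift ^^ d) (sub_seq k n ((shift ^^ i) w))"
      "d < length (subst_letter k n (w i))" using shift_sub_seq by blast
    show ?thesis
    proof (cases d)
      case 0
      with id sub_seq_lex_le[OF k shift_funpow_seqs[OF ws] ws wm] show ?thesis by simp
    next
      case (Suc d')
      have "(shift ^^ r) (sub_seq k n w) 0 = subst_letter k n (w i) ! d"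
        unfolding id(1) shift_funpow using id(2) by (subst sub_seq_unfold) (simp add: shift_funpow)
      also have "\<dots> = 1"
        using id(2) Suc by (auto simp: subst_letter_def simp del: replicate.simps split: if_splits)
      also have "\<dots> < sub_seq k n w 0" using sub_seq_0_ge[OF k ws, of n] by simp
      finally show ?thesis by (intro lex_leI[of _ 0]) auto
    qed
  qed
  with sub_seq_in_seqs[OF k ws] show ?thesis by (simp add: maximal_seqs_def)
qed

subsection \<open>Sequences of bounded discrepancy\<close>

text \<open>Stronger than having rate \<open>\<alpha>\<close>, but easier to carry through a
  substitution or the addition of a finite prefix: only the constant changes.\<close>

definition bounded_dev :: "nat \<Rightarrow> (nat \<Rightarrow> nat) \<Rightarrow> (nat \<Rightarrow> real) \<Rightarrow> bool" where
  "bounded_dev k w \<alpha> \<longleftrightarrow>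
    (\<exists>C. \<forall>r. \<forall>i\<in>{1..k}. \<bar>real (count_list (initial_word w r) i) - real r * \<alpha> i\<bar> \<le> C)"

lemma bounded_dev_rate:
  assumes "w \<in> seqs k" "bounded_dev k w \<alpha>"
  shows "w \<in> rate_seqs k \<alpha>"
proof -
  obtain C where C: "\<And>r i. i \<in> {1..k} \<Longrightarrow>
      \<bar>real (count_list (initial_word w r) i) - real r * \<alpha> i\<bar> \<le> C"
    using assms(2) unfolding bounded_dev_def by blast
  have "(\<lambda>r. real (count_list (initial_word w r) i) / real r) \<longlonglongrightarrow> \<alpha> i" if "i \<in> {1..k}" for i
  proof (rule tendsto_close[OF _ filterlim_real_sequentially])
    show "(\<lambda>r. real r * \<alpha> i / real r) \<longlonglongrightarrow> \<alpha> i"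
      by (rule tendsto_eventually) (use eventually_gt_at_top[of 0] in eventually_elim, simp)
    show "\<forall>\<^sub>F r in sequentially. \<bar>real (count_list (initial_word w r) i) - real r * \<alpha> i\<bar> \<le> C"
      using C[OF that] by simp
  qed
  then show ?thesis using assms(1) by (simp add: rate_seqs_def freq_def)
qed

lemma Simplex_bounds:
  assumes "\<alpha> \<in> Simplex k" "i \<in> {1..k}"
  shows "0 \<le> \<alpha> i" "\<alpha> i \<le> 1"
proof -
  show "0 \<le> \<alpha> i" using assms by (simp add: Simplex_def)
  have "\<alpha> i \<le> sum \<alpha> {1..k}"
    by (rule member_le_sum) (use assms in \<open>auto simp: Simplex_def\<close>)
  then show "\<alpha> i \<le> 1" using assms by (simp add: Simplex_def)
qed

lemma count_subst_word:
  assumes "k \<ge> 2" "set W \<subseteq> {1..k}"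
  shows "count_list (subst_word k n W) 1 = n * count_list W k + (n + 1) * count_list W (k - 1)"
    and "count_list (subst_word k n W) k = count_list W k + count_list W (k - 1)"
    and "1 < i \<Longrightarrow> i < k \<Longrightarrow> count_list (subst_word k n W) i = count_list W (i - 1)"
    and "length (subst_word k n W) = length W + count_list (subst_word k n W) 1"
  using assms(2)
  by (induction W) (use assms(1) in \<open>auto simp: subst_letter_def algebra_simps\<close>)

text \<open>Up to the factor \<open>1 - \<alpha> 1\<close>, \<open>K_map\<close> inverts the matrix
  of letter counts of \<open>\<Lambda>\<^sub>n\<close>. So counts in the image of \<open>m\<close>
  letters stay near \<open>m * \<alpha> i / (1 - \<alpha> 1)\<close>, and the length stays near
  \<open>m / (1 - \<alpha> 1)\<close>.\<close>

lemma bounded_dev_sub_seq_blocks: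
  assumes k: "k \<ge> 2" and a: "\<alpha> \<in> Simplex k" and w: "w \<in> seqs k"
    and bd: "bounded_dev k w (K_map k \<alpha>)"
  defines "L \<equiv> \<lambda>m. subst_word k (J k \<alpha>) (initial_word w m)"
  shows "\<exists>D. \<forall>m. \<forall>i\<in>{1..k}. \<bar>real (count_list (L m) i) - real (length (L m)) * \<alpha> i\<bar> \<le> D"
proof -
  define n where "n = J k \<alpha>"
  define \<mu> where "\<mu> = 1 - \<alpha> 1"
  define \<beta> where "\<beta> = K_map k \<alpha>"
  have \<mu>: "\<mu> > 0" using Simplex_J[OF k a] by (simp add: \<mu>_def)
  obtain C where C: "\<And>r i. i \<in> {1..k} \<Longrightarrow>
      \<bar>real (count_list (initial_word w r) i) - real r * \<beta> i\<bar> \<le> C"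
    using bd unfolding bounded_dev_def \<beta>_def by blast
  have C0: "C \<ge> 0" using C[of 1 0] k by simp
  have b1: "\<alpha> 1 / \<mu> = real n * \<beta> k + real (n + 1) * \<beta> (k - 1)"
    and bk: "\<alpha> k / \<mu> = \<beta> k + \<beta> (k - 1)"
    using \<mu> k unfolding \<beta>_def K_map_def K_branch_def n_def[symmetric] \<mu>_def[symmetric]
    by (auto simp: field_simps)
  have bi: "\<alpha> i / \<mu> = \<beta> (i - 1)" if "1 < i" "i < k" for i
    using that unfolding \<beta>_def K_map_def K_branch_def \<mu>_def by auto
  \<comment> \<open>Covers \<open>n * C + (n + 1) * C\<close> for the letter 1 and
    \<open>2 * C\<close> for the letter \<open>k\<close>.\<close>
  define D where "D = real (2 * n + 2) * C"
  have DC: "C \<le> D" "2 * C \<le> D" using C0 by (auto simp: D_def algebra_simps)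
  have dev: "\<bar>real (count_list (L m) i) - real m * (\<alpha> i / \<mu>)\<bar> \<le> D" if "i \<in> {1..k}" for m i
  proof -
    let ?c = "\<lambda>i. real (count_list (initial_word w m) i)"
    note cs = count_subst_word[OF k set_initial_word[OF w, of m], where n = n]
    have Ck: "\<bar>?c k - real m * \<beta> k\<bar> \<le> C" and Ck1: "\<bar>?c (k - 1) - real m * \<beta> (k - 1)\<bar> \<le> C"
      using C[of k m] C[of "k - 1" m] k by auto
    have "i = 1 \<or> i = k \<and> i \<noteq> 1 \<or> 1 < i \<and> i < k" using that by auto
    then consider "i = 1" | "i = k" "i \<noteq> 1" | "1 < i" "i < k" by blast
    then show ?thesis
    proof cases
      case 1
      have "real (count_list (L m) i) - real m * (\<alpha> i / \<mu>) =
          real n * (?c k - real m * \<beta> k) + real (n + 1) * (?c (k - 1) - real m * \<beta> (k - 1))"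
        unfolding 1 L_def n_def[symmetric] cs(1) b1 by (simp add: algebra_simps)
      also have "\<bar>\<dots>\<bar> \<le> real n * C + real (n + 1) * C"
        using mult_left_mono[OF Ck, of "real n"] mult_left_mono[OF Ck1, of "real (n + 1)"]
        by (intro order_trans[OF abs_triangle_ineq] add_mono) (simp_all add: abs_mult)
      also have "\<dots> \<le> D" using C0 by (simp add: D_def algebra_simps)
      finally show ?thesis .
    next
      case 2
      have "real (count_list (L m) i) - real m * (\<alpha> i / \<mu>) =
          (?c k - real m * \<beta> k) + (?c (k - 1) - real m * \<beta> (k - 1))"
        unfolding 2(1) L_def n_def[symmetric] cs(2) bk by (simp add: algebra_simps)
      then show ?thesis using Ck Ck1 DC by linarith
    next
      case 3
      have "real (count_list (L m) i) - real m * (\<alpha> i / \<mu>) = ?c (i - 1) - real m * \<beta> (i - 1)"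
        unfolding L_def n_def[symmetric] cs(3)[OF 3] bi[OF 3] by simp
      moreover have "\<bar>?c (i - 1) - real m * \<beta> (i - 1)\<bar> \<le> C"
        by (rule C) (use 3 in \<open>unfold atLeastAtMost_iff, linarith\<close>)
      ultimately show ?thesis using DC by linarith
    qed
  qed
  have len: "\<bar>real (length (L m)) - real m / \<mu>\<bar> \<le> D" for m
  proof -
    \<comment> \<open>Every image of a letter contains exactly one letter other than 1.\<close>
    have "real (length (L m)) = real m + real (count_list (L m) 1)"
      using count_subst_word(4)[OF k set_initial_word[OF w, of m], where n = n] by (simp add: L_def n_def)
    moreover have "real m + real m * (\<alpha> 1 / \<mu>) = real m / \<mu>"
      using \<mu> by (simp add: field_simps) (simp add: \<mu>_def algebra_simps)
    ultimately show ?thesis using dev[of 1 m] k by simp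
  qed
  have "\<bar>real (count_list (L m) i) - real (length (L m)) * \<alpha> i\<bar> \<le> 2 * D" if i: "i \<in> {1..k}" for m i
  proof -
    have "\<bar>(real (length (L m)) - real m / \<mu>) * \<alpha> i\<bar> \<le> D * 1"
      unfolding abs_mult using len[of m] Simplex_bounds[OF a i] by (intro mult_mono) auto
    with dev[OF i, of m]
    have "\<bar>(real (count_list (L m) i) - real m * (\<alpha> i / \<mu>)) -
        (real (length (L m)) - real m / \<mu>) * \<alpha> i\<bar> \<le> D + D * 1"
      by (rule order_trans[OF abs_triangle_ineq4 add_mono])
    then show ?thesis by (simp add: left_diff_distrib)
  qed
  then show ?thesis by blast
qed

lemma initial_word_sub_seq:
  assumes "r \<le> length (subst_word k n (initial_word w m))"
  shows "initial_word (sub_seq k n w) r = take r (subst_word k n (initial_word w m))"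
  using assms by (intro nth_equalityI) (auto simp: sub_seq_nth)

text \<open>A prefix consists of complete images and a part of one more. That part has at most n + 2
  letters, so it changes the count and its expected value by at most n + 2 each.\<close>

lemma bounded_dev_sub_seq:
  assumes k: "k \<ge> 2" and a: "\<alpha> \<in> Simplex k" and w: "w \<in> seqs k"
    and bd: "bounded_dev k w (K_map k \<alpha>)"
  shows "bounded_dev k (sub_seq k (J k \<alpha>) w) \<alpha>"
proof -
  define n where "n = J k \<alpha>"
  define L where "L m = subst_word k n (initial_word w m)" for m
  obtain D where D: "\<And>m i. i \<in> {1..k} \<Longrightarrow>
      \<bar>real (count_list (L m) i) - real (length (L m)) * \<alpha> i\<bar> \<le> D"
    using bounded_dev_sub_seq_blocks[OF k a w bd] unfolding L_def n_def by blast
  have "\<bar>real (count_list (initial_word (sub_seq k n w) r) i) - real r * \<alpha> i\<bar> \<le> D + 2 * real (n + 2)"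
    if i: "i \<in> {1..k}" for r i
  proof -
    have ex: "r < length (L (Suc r))"
      using length_subst_word_ge[of "initial_word w (Suc r)" k n] by (simp add: L_def)
    define m where "m = (LEAST m. r < length (L (Suc m)))"
    have m: "r < length (L (Suc m))" unfolding m_def using ex by (rule LeastI)
    have m': "length (L m) \<le> r"
    proof (cases m)
      case (Suc m0)
      then have "\<not> r < length (L (Suc m0))"
        using not_less_Least[of m0 "\<lambda>m. r < length (L (Suc m))"] by (simp add: m_def)
      with Suc show ?thesis by simp
    qed (simp add: L_def)
    have LS: "L (Suc m) = L m @ subst_letter k n (w m)"
      by (simp add: L_def initial_word_snoc)
    define X where "X = take (r - length (L m)) (subst_letter k n (w m))"
    have iw: "initial_word (sub_seq k n w) r = L m @ X"
      using initial_word_sub_seq[of r k n w "Suc m"] m m' LS unfolding L_def[symmetric] X_def by simp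
    have r: "r = length (L m) + length X"
      using arg_cong[OF iw, of length] by simp
    have X: "length X \<le> n + 2" using length_subst_letter(2)[of k n "w m"] by (simp add: X_def)
    have est: "\<bar>a + c - e\<bar> \<le> D + 2 * N" if "\<bar>a\<bar> \<le> D" "0 \<le> c" "c \<le> N" "0 \<le> e" "e \<le> N * 1"
      for a c e N :: real using that by linarith
    have eq: "real (count_list (initial_word (sub_seq k n w) r) i) - real r * \<alpha> i =
        (real (count_list (L m) i) - real (length (L m)) * \<alpha> i) + real (count_list X i)
         - real (length X) * \<alpha> i"
      unfolding iw by (subst r) (simp add: algebra_simps)
    show ?thesis
      unfolding eq
    proof (rule est[OF D[OF i]])
      show "real (count_list X i) \<le> real (n + 2)" using count_list_le_length[of X i] X by linarith
      show "real (length X) * \<alpha> i \<le> real (n + 2) * 1"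
        by (rule mult_mono) (use X Simplex_bounds[OF a i] in auto)
    qed (use Simplex_bounds[OF a i] in simp_all)
  qed
  then show ?thesis unfolding bounded_dev_def n_def by blast
qed

section \<open>Maximal sequences with a long initial run of \<open>k\<close>\<close>

primrec greedy :: "(nat list \<Rightarrow> nat) \<Rightarrow> nat \<Rightarrow> nat list" where
  "greedy f 0 = []"
| "greedy f (Suc r) = greedy f r @ [f (greedy f r)]"

lemma initial_word_greedy: "initial_word (\<lambda>r. f (greedy f r)) r = greedy f r"
  by (induction r) (simp_all add: initial_word_snoc)

text \<open>Always append a letter that is still underrepresented: then no letter is ever more than one
  occurrence ahead, hence none is more than \<open>k\<close> behind.\<close>

lemma ex_balanced_seq:
  assumes b: "\<beta> \<in> Simplex k"
  shows "\<exists>v\<in>seqs k. \<forall>r. \<forall>i\<in>{1..k}.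
    \<bar>real (count_list (initial_word v r) i) - real r * \<beta> i\<bar> \<le> real k"
proof -
  have s: "sum \<beta> {1..k} = 1" using b by (simp add: Simplex_def)
  have k1: "1 \<le> k" using b by (cases k) (auto simp: Simplex_def)
  \<comment> \<open>The expected counts for length \<open>length W + 1\<close> add up to one more
    than the actual counts, so some letter falls short.\<close>
  have "\<exists>i\<in>{1..k}. real (count_list W i) < real (length W + 1) * \<beta> i" if "set W \<subseteq> {1..k}" for W
  proof (rule ccontr)
    assume "\<not> ?thesis"
    then have "(\<Sum>i\<in>{1..k}. real (length W + 1) * \<beta> i) \<le> (\<Sum>i\<in>{1..k}. real (count_list W i))"
      by (intro sum_mono) (meson linorder_not_less)
    then have "real (length W + 1) \<le> real (sum (count_list W) {1..k})"
      unfolding sum_distrib_left[symmetric] s of_nat_sum by simp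
    with sum_count_set[OF that] show False by simp
  qed
  then obtain f where f: "\<And>W. set W \<subseteq> {1..k} \<Longrightarrow> f W \<in> {1..k} \<and>
      real (count_list W (f W)) < real (length W + 1) * \<beta> (f W)" by metis
  have len: "length (greedy f r) = r" for r by (induction r) auto
  have set: "set (greedy f r) \<subseteq> {1..k}" for r using f by (induction r) auto
  have up: "real (count_list (greedy f r) i) \<le> real r * \<beta> i + 1" if i: "i \<in> {1..k}" for r i
  proof (induction r)
    case (Suc r)
    show ?case
    proof (cases "f (greedy f r) = i")
      case True
      with f[OF set[of r]] show ?thesis by (simp add: len add.commute)
    next
      case False
      with Suc Simplex_bounds[OF b i] show ?thesis by (simp add: distrib_right)
    qed
  qed simp
  have lo: "real r * \<beta> i - real k \<le> real (count_list (greedy f r) i)" if i: "i \<in> {1..k}" for r i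
  proof -
    have "real r = (\<Sum>j\<in>{1..k}. real (count_list (greedy f r) j))"
      using sum_count_set[OF set[of r], unfolded len] by (simp flip: of_nat_sum)
    also have "\<dots> = real (count_list (greedy f r) i) + (\<Sum>j\<in>{1..k} - {i}. real (count_list (greedy f r) j))"
      using i by (simp add: sum.remove)
    also have "(\<Sum>j\<in>{1..k} - {i}. real (count_list (greedy f r) j)) \<le> (\<Sum>j\<in>{1..k} - {i}. real r * \<beta> j + 1)"
      by (intro sum_mono up) auto
    also have "\<dots> = (\<Sum>j\<in>{1..k}. real r * \<beta> j + 1) - (real r * \<beta> i + 1)"
      using i by (simp add: sum_diff1)
    also have "(\<Sum>j\<in>{1..k}. real r * \<beta> j + 1) = real r + real k"
      unfolding sum.distrib sum_distrib_left[symmetric] s by simp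
    finally show ?thesis by simp
  qed
  show ?thesis
  proof (intro bexI[of _ "\<lambda>r. f (greedy f r)"] allI ballI)
    show "(\<lambda>r. f (greedy f r)) \<in> seqs k" using f[OF set] by (simp add: seqs_def alphabet_def)
    fix r i assume i: "i \<in> {1..k}"
    show "\<bar>real (count_list (initial_word (\<lambda>r. f (greedy f r)) r) i) - real r * \<beta> i\<bar> \<le> real k"
      unfolding initial_word_greedy using up[OF i, of r] lo[OF i, of r] k1 by linarith
  qed
qed

text \<open>The initial run of \<open>k\<close> has a length b that is at least \<open>a\<close>.
  From any later start a letter other than \<open>k\<close> appears after fewer than b steps: inside
  the first run because it ends at b, afterwards by \<open>short\<close>. At that place
  \<open>w\<close> still reads \<open>k\<close>.\<close>

lemma maximal_longest_run:
  assumes w: "w \<in> seqs k" and run: "\<And>q. q < a \<Longrightarrow> w q = k"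
    and short: "\<And>r. r \<ge> a \<Longrightarrow> \<exists>q<a. w (r + q) \<noteq> k"
  shows "w \<in> maximal_seqs k"
proof -
  define b where "b = (LEAST q. w q \<noteq> k)"
  have ex: "\<exists>q. w q \<noteq> k" using short[of a] by blast
  have b: "w b \<noteq> k" unfolding b_def using ex by (rule LeastI_ex)
  have b': "w q = k" if "q < b" for q using not_less_Least[OF that[unfolded b_def]] by simp
  have ab: "a \<le> b" using b run by (meson not_le)
  have le: "w q \<le> k" for q using w by (simp add: seqs_def alphabet_def)
  have "lex_le ((shift ^^ r) w) w" for r
  proof (cases "r = 0")
    case True
    then show ?thesis by (simp add: lex_le_def)
  next
    case False
    have ex': "\<exists>q<b. w (r + q) \<noteq> k"
    proof (cases "r \<le> b")
      case True
      with False b show ?thesis by (intro exI[of _ "b - r"]) auto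
    next
      case False
      with short[of r] ab show ?thesis by (meson le_trans less_le_trans nat_le_linear)
    qed
    define q where "q = (LEAST q. w (r + q) \<noteq> k)"
    from ex' have "\<exists>q. w (r + q) \<noteq> k" by blast
    then have q: "w (r + q) \<noteq> k" unfolding q_def by (rule LeastI_ex)
    have q': "w (r + s) = k" if "s < q" for s using not_less_Least[OF that[unfolded q_def]] by simp
    have "q < b" using ex' q' by (meson linorder_not_less order.strict_trans2)
    then show ?thesis
      using q q' b' le[of "r + q"] by (intro lex_leI[of _ q]) (auto simp: shift_funpow)
  qed
  with w show ?thesis by (simp add: maximal_seqs_def)
qed

lemma initial_word_add:
  "initial_word w (a + r) = initial_word w a @ initial_word ((shift ^^ a) w) r"
  by (rule nth_equalityI) (auto simp: nth_append shift_funpow)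

lemma initial_word_const: "initial_word (\<lambda>_. c) r = replicate r c"
  by (rule nth_equalityI) auto

text \<open>Puts a run of \<open>k\<close> in front of a balanced sequence, longer than every run of
  \<open>k\<close> in it. For \<open>\<beta> k = 1\<close> such runs need not be bounded, but the
  constant sequence \<open>k\<close> serves.\<close>

lemma ex_maximal_prefix:
  assumes k: "k \<ge> 2" and b: "\<beta> \<in> Simplex k"
  shows "\<exists>w\<in>maximal_seqs k. bounded_dev k w \<beta> \<and> initial_word w m = replicate m k"
proof (cases "\<beta> k = 1")
  case True
  have "\<beta> i = (if i = k then 1 else 0)" if i: "i \<in> {1..k}" for i
  proof (cases "i = k")
    case False
    have "sum \<beta> {i, k} \<le> sum \<beta> {1..k}"
      by (rule sum_mono2) (use b i k in \<open>auto simp: Simplex_def\<close>)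
    then have "\<beta> i \<le> 0" using b True False by (simp add: Simplex_def)
    with Simplex_bounds[OF b i] False show ?thesis by simp
  qed (use True in simp)
  then have "bounded_dev k (\<lambda>_. k) \<beta>"
    unfolding bounded_dev_def initial_word_const by (intro exI[of _ 0]) auto
  moreover have "(\<lambda>_. k) \<in> maximal_seqs k"
    using k by (auto simp: maximal_seqs_def seqs_def alphabet_def lex_le_def shift_funpow fun_eq_iff)
  ultimately show ?thesis using initial_word_const by blast
next
  case False
  then have bk: "\<beta> k < 1" using Simplex_bounds[OF b, of k] k by simp
  obtain v where v: "v \<in> seqs k" and dev: "\<And>r i. i \<in> {1..k} \<Longrightarrow>
      \<bar>real (count_list (initial_word v r) i) - real r * \<beta> i\<bar> \<le> real k"
    using ex_balanced_seq[OF b] by blast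
  \<comment> \<open>A run of \<open>a\<close> letters \<open>k\<close> in \<open>v\<close> changes
    the deviation of this letter by \<open>a * (1 - \<beta> k)\<close>, which the balance limits to
    \<open>2 * k\<close>.\<close>
  obtain a0 where a0: "2 * real k / (1 - \<beta> k) < real a0" using reals_Archimedean2 by blast
  define a where "a = max a0 (Suc m)"
  have "2 * real k / (1 - \<beta> k) < real a" using a0 by (simp add: a_def)
  then have a: "2 * real k < real a * (1 - \<beta> k)" using bk by (simp add: field_simps)
  have norun: "\<exists>q<a. v (r + q) \<noteq> k" for r
  proof (rule ccontr)
    assume "\<not> ?thesis"
    then have "initial_word ((shift ^^ r) v) a = replicate a k"
      by (intro nth_equalityI) (auto simp: shift_funpow)
    then have "real (count_list (initial_word v (r + a)) k) = real (count_list (initial_word v r) k) + real a"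
      by (simp add: initial_word_add)
    with dev[of k "r + a"] dev[of k r] a k show False by (simp add: algebra_simps abs_le_iff)
  qed
  define w where "w q = (if q < a then k else v (q - a))" for q
  have ws: "w \<in> seqs k" using v k by (auto simp: w_def seqs_def alphabet_def)
  have "w \<in> maximal_seqs k"
  proof (rule maximal_longest_run[OF ws, of a])
    fix r assume "a \<le> r"
    then have "w (r + q) = v (r - a + q)" for q by (simp add: w_def)
    with norun[of "r - a"] show "\<exists>q<a. w (r + q) \<noteq> k" by simp
  qed (simp add: w_def)
  moreover have "initial_word w m = replicate m k"
    by (rule nth_equalityI) (auto simp: w_def a_def)
  moreover have "bounded_dev k w \<beta>"
    unfolding bounded_dev_def
  proof (intro exI[of _ "2 * real a + real k"] allI ballI)
    fix r i assume i: "i \<in> {1..k}"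
    have e: "initial_word w r = replicate (min r a) k @ initial_word v (r - a)"
      by (rule nth_equalityI) (auto simp: w_def nth_append)
    have c: "real (count_list (initial_word w r) i) =
        real (count_list (replicate (min r a) k) i) + real (count_list (initial_word v (r - a)) i)"
      unfolding e by simp
    have est: "\<bar>x + y - (e + z)\<bar> \<le> 2 * A + C"
      if "\<bar>y - z\<bar> \<le> C" "0 \<le> x" "x \<le> A" "0 \<le> e" "e \<le> A" for x y z e A C :: real
      using that by linarith
    have r: "real r * \<beta> i = real (min r a) * \<beta> i + real (r - a) * \<beta> i"
      unfolding distrib_right[symmetric] of_nat_add[symmetric] by (simp add: min_def)
    have "real (min r a) * \<beta> i \<le> real a * 1"
      by (rule mult_mono) (use Simplex_bounds[OF b i] in auto)
    then show "\<bar>real (count_list (initial_word w r) i) - real r * \<beta> i\<bar> \<le> 2 * real a + real k"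
      unfolding c r by (intro est[OF dev[OF i]]) (use Simplex_bounds[OF b i] in auto)
  qed
  ultimately show ?thesis by blast
qed

section \<open>Approximation of \<open>S_seq\<close> and the infimum\<close>

lemma ex_maximal_subst_comp:
  assumes k: "k \<ge> 2" and a: "\<alpha> \<in> Simplex k"
    and "w \<in> maximal_seqs k" "bounded_dev k w ((K_map k ^^ Suc r) \<alpha>)" "initial_word w (length U) = U"
  defines "V \<equiv> subst_comp k (itinerary k \<alpha>) r U"
  shows "\<exists>w\<in>maximal_seqs k. bounded_dev k w \<alpha> \<and> initial_word w (length V) = V"
proof -
  \<comment> \<open>One substitution, leading from rate \<open>K_map k \<gamma>\<close> back to rate
    \<open>\<gamma>\<close>; it is stated for all \<open>\<gamma>\<close> because the induction
    applies it along the orbit of \<open>\<alpha>\<close>.\<close>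
  have step: "sub_seq k (J k \<gamma>) w \<in> maximal_seqs k \<and> bounded_dev k (sub_seq k (J k \<gamma>) w) \<gamma> \<and>
      initial_word (sub_seq k (J k \<gamma>) w) (length (subst_word k (J k \<gamma>) U)) = subst_word k (J k \<gamma>) U"
    if "\<gamma> \<in> Simplex k" "w \<in> maximal_seqs k" "bounded_dev k w (K_map k \<gamma>)"
      "initial_word w (length U) = U" for \<gamma> w U
  proof (intro conjI)
    show "sub_seq k (J k \<gamma>) w \<in> maximal_seqs k" by (rule sub_seq_maximal[OF k that(2)])
    show "bounded_dev k (sub_seq k (J k \<gamma>) w) \<gamma>"
      using that(2) by (intro bounded_dev_sub_seq[OF k that(1) _ that(3)]) (simp add: maximal_seqs_def)
    show "initial_word (sub_seq k (J k \<gamma>) w) (length (subst_word k (J k \<gamma>) U)) = subst_word k (J k \<gamma>) U"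
      using initial_word_sub_seq[of _ k "J k \<gamma>" w "length U", unfolded that(4), OF order_refl]
      by (simp only: take_all_iff order_refl)
  qed
  show ?thesis
    unfolding V_def using assms(3-5)
  proof (induction r arbitrary: w U)
    case 0
    with step[OF a, of w U] show ?case by (auto simp: itinerary_def)
  next
    case (Suc r)
    let ?\<gamma> = "(K_map k ^^ Suc r) \<alpha>"
    have "bounded_dev k w (K_map k ?\<gamma>)" using Suc.prems(2) by simp
    from step[OF K_iter_in_Simplex[OF k a] Suc.prems(1) this Suc.prems(3)]
    show ?case using Suc.IH unfolding itinerary_def subst_comp.simps o_apply by blast
  qed
qed

text \<open>A maximal sequence starting with p + 1 letters \<open>k\<close> is pushed through the
  first r + 1 substitutions. Images do not shorten words, so the image of that run covers the places
  up to p, where it agrees with \<open>S_seq\<close>.\<close>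

lemma S_seq_approximated:
  assumes k: "k \<ge> 2" and a: "\<alpha> \<in> Simplex k"
  shows "\<exists>w\<in>maximal_rate_seqs k \<alpha>. \<forall>q\<le>p. w q = S_seq k (itinerary k \<alpha>) q"
proof -
  let ?ns = "itinerary k \<alpha>"
  obtain r where r: "\<And>q. q \<le> p \<Longrightarrow> periodic_seq (subst_comp k ?ns r [k]) q = S_seq k ?ns q"
    by (rule S_seq_agrees[of p k ?ns]) blast
  define V where "V = subst_comp k ?ns r (replicate (Suc p) k)"
  obtain w0 where w0: "w0 \<in> maximal_seqs k" "bounded_dev k w0 ((K_map k ^^ Suc r) \<alpha>)"
    "initial_word w0 (Suc p) = replicate (Suc p) k"
    using ex_maximal_prefix[OF k K_iter_in_Simplex[OF k a, of "Suc r"], of "Suc p"] by blast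
  have "initial_word w0 (length (replicate (Suc p) k)) = replicate (Suc p) k"
    unfolding length_replicate by (rule w0(3))
  from ex_maximal_subst_comp[OF k a w0(1,2) this]
  obtain w where w: "w \<in> maximal_seqs k" "bounded_dev k w \<alpha>" "initial_word w (length V) = V"
    unfolding V_def by blast
  have len: "Suc p \<le> length V"
    unfolding V_def using length_subst_comp_ge[of "replicate (Suc p) k" k ?ns r] by simp
  have "w q = S_seq k ?ns q" if "q \<le> p" for q
  proof -
    have q: "q < length V" using len that by simp
    then have "w q = V ! q" using w(3) by (metis nth_initial_word)
    also have "\<dots> = periodic_seq (subst_comp k ?ns r [k]) q"
      using nth_concat_replicate[OF subst_comp_nonempty] q
      unfolding V_def subst_comp_replicate length_concat_replicate by blast
    finally show ?thesis using r[OF that] by simp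
  qed
  moreover have "w \<in> maximal_rate_seqs k \<alpha>"
    using w(1,2) bounded_dev_rate by (auto simp: maximal_rate_seqs_def maximal_seqs_def)
  ultimately show ?thesis by blast
qed

theorem theorem22:
  fixes k :: nat and \<alpha> :: "nat \<Rightarrow> real"
  assumes "k \<ge> 2" and "\<alpha> \<in> Simplex k"
  shows "infimax k \<alpha> = S_seq k (itinerary k \<alpha>) \<and>
         is_seq_inf k (maximal_rate_seqs k \<alpha>) (S_seq k (itinerary k \<alpha>))"
proof -
  let ?S = "S_seq k (itinerary k \<alpha>)" and ?M = "maximal_rate_seqs k \<alpha>"
  \<comment> \<open>Each letter of \<open>?S\<close> is a letter of some approximating member of
    \<open>?M\<close>.\<close>
  have "?S \<in> seqs k"
    unfolding seqs_def
  proof (intro CollectI allI)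
    fix q
    obtain w where "w \<in> ?M" "w q = ?S q" using S_seq_approximated[OF assms, of q] by blast
    then show "?S q \<in> alphabet k"
      by (auto simp: maximal_rate_seqs_def maximal_seqs_def seqs_def dest: sym)
  qed
  \<comment> \<open>A lower bound above \<open>?S\<close> would exceed a member of \<open>?M\<close>
    that agrees with \<open>?S\<close> up to and including the first difference.\<close>
  moreover have "lex_le l ?S" if l: "\<forall>w\<in>?M. lex_le l w" for l
  proof (rule ccontr)
    assume "\<not> lex_le l ?S"
    then obtain p where p: "?S p < l p" "\<And>q. q < p \<Longrightarrow> ?S q = l q"
      by (rule lex_linear) blast
    obtain w where w: "w \<in> ?M" "\<forall>q\<le>p. w q = ?S q" using S_seq_approximated[OF assms, of p] by blast
    have "lex_le w l" using w(2) p by (intro lex_leI[of _ p]) auto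
    with l w(1) have "w = l" by (blast intro: lex_le_antisym)
    with p(1) w(2) show False by simp
  qed
  ultimately have "is_seq_inf k ?M ?S"
    using S_seq_lower_bound[OF assms] unfolding is_seq_inf_def by blast
  then show ?thesis by (simp add: infimax_def seq_inf_eqI)
qed

end
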